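(* Let $n \geq 1$, and let $\varphi_1$ and $\varphi_2$ be nonconstant inner functions in $H^{\infty}(\mathbb{D}^n)$. Then the truncated Toeplitz operator $T_{\varphi_2}^{\varphi_1}$ is a partial isometry on $\mathcal{Q}_{\varphi_1}$ if and only if the truncated Toeplitz operator $T_{\varphi_1}^{\varphi_2}$ is a partial isometry on $\mathcal{Q}_{\varphi_2}$.
   Context: $\mathbb{D}^n$ is the open unit polydisc in $\mathbb{C}^n$ and $\mathbb{T}^n$ its distinguished boundary. $H^\infty(\mathbb{D}^n)$ is the algebra of bounded analytic functions on $\mathbb{D}^n$. $H^2(\mathbb{D}^n)$ is the Hardy space of analytic functions $f$ on $\mathbb{D}^n$ with $\|f\|^2 = \sup_{0 \le r < 1} \int_{\mathbb{T}^n} |f(rz_1,\ldots,rz_n)|^2\, dm(z) < \infty$, where $m$ is normalized Lebesgue measure on $\mathbb{T}^n$. A function $\varphi \in H^\infty(\mathbb{D}^n)$ is inner if its radial boundary values satisfy $|\varphi(z)| = 1$ for almost every $z \in \mathbb{T}^n$. The model space of an inner function $\varphi$ is $\mathcal{Q}_\varphi = H^2(\mathbb{D}^n) \ominus \varphi H^2(\mathbb{D}^n)$. For inner functions $\varphi, \theta$, the truncated Toeplitz operator $T^{\varphi}_{\theta} : \mathcal{Q}_{\varphi} \to \mathcal{Q}_{\varphi}$ is defined by $T^{\varphi}_{\theta} f = P_{\mathcal{Q}_{\varphi}}(\theta f)$, where $P_{\mathcal{Q}_{\varphi}}$ is the orthogonal projection onto $\mathcal{Q}_{\varphi}$. A bounded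 operator $T$ is a partial isometry if $T|_{(\ker T)^\perp}$ is an isometry. *)

theory Defs
  imports "HOL-Analysis.Analysis"
begin

definition polydisc :: "(complex ^ 'n::finite) set" where
  "polydisc = {z. \<forall>i. cmod (z $ i) < 1}"

(* Normalized Lebesgue measure on the distinguished boundary, as a Borel measure on complex ^ 'n. *)
definition circle_measure :: "complex measure" where
  "circle_measure = distr (uniform_measure lborel {0..<2 * pi}) borel cis"

definition torus_measure :: "(complex ^ 'n::finite) measure" where
  "torus_measure = distr (\<Pi>\<^sub>M i\<in>UNIV. circle_measure) borel (\<lambda>x. \<chi> i. x i)"

(* Complex Frechet differentiability: the real derivative exists and is complex-linear.
   The library's holomorphic_on covers only functions of one variable. *)
definition analytic_on_polydisc :: "(complex ^ 'n::finite \<Rightarrow> complex) \<Rightarrow> bool" where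
  "analytic_on_polydisc f \<longleftrightarrow>
     (\<forall>z\<in>polydisc. \<exists>f'. (f has_derivative f') (at z) \<and> (\<forall>c v. f' (c *s v) = c * f' v))"

(* Only the values on the polydisc matter here; no convention is imposed outside of it. *)
definition Hardy_infty :: "(complex ^ 'n::finite \<Rightarrow> complex) set" where
  "Hardy_infty = {f. analytic_on_polydisc f \<and> bounded (f ` polydisc)}"

definition inner_function :: "(complex ^ 'n::finite \<Rightarrow> complex) \<Rightarrow> bool" where
  "inner_function \<phi> \<longleftrightarrow> \<phi> \<in> Hardy_infty \<and>
     (AE z in torus_measure. \<exists>w. ((\<lambda>r. \<phi> (r *\<^sub>R z)) \<longlongrightarrow> w) (at_left 1) \<and> cmod w = 1)"

definition radial_mean :: "(complex ^ 'n::finite \<Rightarrow> complex) \<Rightarrow> real \<Rightarrow> real" where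
  "radial_mean f r = (LINT z|torus_measure. (cmod (f (r *\<^sub>R z)))\<^sup>2)"

(* Elements of the Hardy space are normalized to be 0 outside the polydisc, so that equality
   of functions on the polydisc is equality in HOL. *)
definition Hardy2 :: "(complex ^ 'n::finite \<Rightarrow> complex) set" where
  "Hardy2 = {f. analytic_on_polydisc f \<and> (\<forall>z. z \<notin> polydisc \<longrightarrow> f z = 0) \<and>
                bdd_above (radial_mean f ` {0..<1})}"

definition hnorm :: "(complex ^ 'n::finite \<Rightarrow> complex) \<Rightarrow> real" where
  "hnorm f = sqrt (SUP r\<in>{0..<1}. radial_mean f r)"

(* The inner product inducing hnorm, recovered by polarization;
   linear in the first and conjugate-linear in the second argument. *)
definition hinner :: "(complex ^ 'n::finite \<Rightarrow> complex) \<Rightarrow> (complex ^ 'n \<Rightarrow> complex) \<Rightarrow> complex" where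
  "hinner f g = (\<Sum>k<4. \<i> ^ k * complex_of_real ((hnorm (\<lambda>z. f z + \<i> ^ k * g z))\<^sup>2)) / 4"

definition orth_compl ::
    "(complex ^ 'n::finite \<Rightarrow> complex) set \<Rightarrow> (complex ^ 'n \<Rightarrow> complex) set \<Rightarrow> (complex ^ 'n \<Rightarrow> complex) set"
  where "orth_compl S M = {f \<in> S. \<forall>g\<in>M. hinner f g = 0}"

definition model_space :: "(complex ^ 'n::finite \<Rightarrow> complex) \<Rightarrow> (complex ^ 'n \<Rightarrow> complex) set" where
  "model_space \<phi> = orth_compl Hardy2 ((\<lambda>g z. \<phi> z * g z) ` Hardy2)"

definition orth_proj ::
    "(complex ^ 'n::finite \<Rightarrow> complex) set \<Rightarrow> (complex ^ 'n \<Rightarrow> complex) \<Rightarrow> complex ^ 'n \<Rightarrow> complex"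
  where "orth_proj S f = (THE g. g \<in> S \<and> (\<forall>h\<in>S. hinner (\<lambda>z. f z - g z) h = 0))"

(* The first argument determines the model space, the second one is the symbol. *)
definition truncated_Toeplitz ::
    "(complex ^ 'n::finite \<Rightarrow> complex) \<Rightarrow> (complex ^ 'n \<Rightarrow> complex) \<Rightarrow>
     (complex ^ 'n \<Rightarrow> complex) \<Rightarrow> complex ^ 'n \<Rightarrow> complex"
  where "truncated_Toeplitz \<phi> \<theta> f = orth_proj (model_space \<phi>) (\<lambda>z. \<theta> z * f z)"

definition bounded_operator_on ::
    "(complex ^ 'n::finite \<Rightarrow> complex) set \<Rightarrow>
     ((complex ^ 'n \<Rightarrow> complex) \<Rightarrow> complex ^ 'n \<Rightarrow> complex) \<Rightarrow> bool"
  where "bounded_operator_on S T \<longleftrightarrow>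
     (\<forall>f\<in>S. T f \<in> S) \<and>
     (\<forall>f\<in>S. \<forall>g\<in>S. T (\<lambda>z. f z + g z) = (\<lambda>z. T f z + T g z)) \<and>
     (\<forall>c. \<forall>f\<in>S. T (\<lambda>z. c * f z) = (\<lambda>z. c * T f z)) \<and>
     (\<exists>C. \<forall>f\<in>S. hnorm (T f) \<le> C * hnorm f)"

definition partial_isometry_on ::
    "(complex ^ 'n::finite \<Rightarrow> complex) set \<Rightarrow>
     ((complex ^ 'n \<Rightarrow> complex) \<Rightarrow> complex ^ 'n \<Rightarrow> complex) \<Rightarrow> bool"
  where "partial_isometry_on S T \<longleftrightarrow>
     bounded_operator_on S T \<and>
     (\<forall>f \<in> orth_compl S {g \<in> S. T g = (\<lambda>z. 0)}. hnorm (T f) = hnorm f)"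

end

theory Submission
  imports Defs "HOL-Probability.Probability" "HOL-Complex_Analysis.Complex_Analysis"
begin

text \<open>Let \<open>V\<^sub>i\<close> be the multiplication by \<open>\<phi>\<^sub>i\<close> on the Hardy space \<open>H\<close>, and \<open>Q\<^sub>i\<close> the orthogonal
complement of \<open>V\<^sub>i H\<close>. These are commuting isometries, and for \<open>f \<in> Q\<^sub>1\<close> the truncated Toeplitz
operator is \<open>T f = P V\<^sub>2 f\<close>, with \<open>P\<close> the projection onto \<open>Q\<^sub>1\<close>. Its kernel is \<open>N\<^sub>1 = {f \<in> Q\<^sub>1.
V\<^sub>2 f \<in> V\<^sub>1 H}\<close>. Since \<open>V\<^sub>2\<close> preserves norms, \<open>T\<close> preserves the norm of \<open>f\<close> exactly when \<open>V\<^sub>2 f \<in>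
Q\<^sub>1\<close>. So \<open>T\<close> is a partial isometry if and only if \<open>V\<^sub>2\<close> maps \<open>Q\<^sub>1 \<ominus> N\<^sub>1\<close> into \<open>Q\<^sub>1\<close>, that is, if
and only if \<open>X = V\<^sub>1\<^sup>* V\<^sub>2\<close> vanishes on \<open>Q\<^sub>1 \<ominus> N\<^sub>1\<close>. This condition is symmetric in the two
indices: \<open>X\<close> maps \<open>Q\<^sub>1\<close> into \<open>Q\<^sub>2\<close> and \<open>N\<^sub>1\<close> onto \<open>N\<^sub>2\<close>, and its adjoint \<open>V\<^sub>2\<^sup>* V\<^sub>1\<close> on \<open>Q\<^sub>2\<close> is
the operator \<open>X\<close> of the exchanged problem. The lemma \<open>compression_partial_isometry_swap\<close> is this
argument, written without adjoints.

What remains is that \<open>H\<close> is a Hilbert space and that inner functions act on it isometrically. Both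
come from one-variable theory on slices \<open>x \<mapsto> f (a + x v)\<close>. The measure of the torus is invariant
under rotations of any set of coordinates, so a mean over the torus can be taken over circles
first (\<open>nn_integral_torus_rot\<close>).

Rotating all coordinates at once, Parseval's identity on circles yields \<open>radial_mean_dilation\<close>:
with \<open>f\<^sub>s z = f (s z)\<close>, the mean of \<open>|f - f\<^sub>s|\<^sup>2\<close> plus the mean of \<open>|f\<^sub>s|\<^sup>2\<close> is at most that of
\<open>|f|\<^sup>2\<close>. Hence the means increase with the radius, so that the supremum in the norm is a limit and
the norm comes from an inner product; and the dilations \<open>f\<^sub>s\<close> converge to \<open>f\<close> in norm. Rotating
one coordinate after the other, the bound of a power series by its mean over a circle yields
bounded point evaluations (\<open>point_evaluation\<close>), so that Cauchy sequences converge locally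
uniformly and the space is complete.

For an inner \<open>\<phi>\<close> and \<open>s < 1\<close>, dominated convergence at the boundary gives \<open>\<parallel>\<phi> f\<^sub>s\<parallel> = \<parallel>f\<^sub>s\<parallel>\<close>,
because \<open>f\<^sub>s\<close> is continuous up to the torus and \<open>|\<phi>|\<close> has radial limit 1 almost everywhere;
letting \<open>s\<close> tend to 1 proves that multiplication by \<open>\<phi>\<close> is isometric
(\<open>linear_isometry_hardy_mult\<close>).\<close>

(* Keeps the dollar sign free for the components of a vector. *)
unbundle no fps_syntax

section \<open>Commuting isometries of a Hilbert space\<close>

text \<open>The classical minimization argument: by the parallelogram law a minimizing sequence for the
distance from \<open>x\<close> to \<open>S\<close> is Cauchy, and at the minimizer \<open>p\<close> the first variation in every
direction \<open>h \<in> S\<close> vanishes.\<close>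
lemma orthogonal_projection_exists:
  fixes S :: "'a::{real_inner, complete_space} set"
  assumes "subspace S" and "closed S"
  shows "\<exists>p\<in>S. \<forall>h\<in>S. (x - p) \<bullet> h = 0"
proof -
  define d where "d = (INF s\<in>S. (norm (x - s))\<^sup>2)"
  have S0: "0 \<in> S" using assms(1) by (rule subspace_0)
  have bdd: "bdd_below ((\<lambda>s. (norm (x - s))\<^sup>2) ` S)" by (rule bdd_belowI2[where m = 0]) simp
  have dle: "d \<le> (norm (x - s))\<^sup>2" if "s \<in> S" for s
    unfolding d_def by (rule cINF_lower[OF bdd that])
  have "\<exists>s\<in>S. (norm (x - s))\<^sup>2 < d + 1 / real (Suc n)" for n
  proof -
    have "(INF s\<in>S. (norm (x - s))\<^sup>2) < d + 1 / real (Suc n)" by (simp add: d_def)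
    then show ?thesis by (subst (asm) cINF_less_iff) (use S0 bdd in auto)
  qed
  then obtain s where s: "\<And>n. s n \<in> S" "\<And>n. (norm (x - s n))\<^sup>2 < d + 1 / real (Suc n)" by metis
  \<comment> \<open>Parallelogram law for \<open>x - s m\<close> and \<open>x - s n\<close>, whose midpoint is at distance at least \<open>sqrt d\<close>.\<close>
  have par: "(norm (s m - s n))\<^sup>2 \<le> 2 / real (Suc m) + 2 / real (Suc n)" for m n
  proof -
    have "(1/2) *\<^sub>R (s m + s n) \<in> S"
      using s(1) assms(1) by (simp add: subspace_add subspace_scale)
    then have "d \<le> (norm (x - (1/2) *\<^sub>R (s m + s n)))\<^sup>2" by (rule dle)
    moreover have "(norm (s m - s n))\<^sup>2 = 2 * (norm (x - s m))\<^sup>2 + 2 * (norm (x - s n))\<^sup>2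
        - 4 * (norm (x - (1/2) *\<^sub>R (s m + s n)))\<^sup>2"
      by (simp add: power2_norm_eq_inner inner_diff_left inner_diff_right inner_add_left inner_add_right
          inner_commute algebra_simps)
    ultimately show ?thesis using s(2)[of m] s(2)[of n] by simp
  qed
  have "Cauchy s"
  proof (rule metric_CauchyI)
    fix e :: real assume e: "e > 0"
    then obtain N where N: "4 / e\<^sup>2 < real N" using reals_Archimedean2 by blast
    have "dist (s m) (s n) < e" if "m \<ge> N" "n \<ge> N" for m n
    proof -
      have "2 / real (Suc k) < e\<^sup>2 / 2" if "k \<ge> N" for k
      proof -
        have "4 / e\<^sup>2 < real (Suc k)" using N that by linarith
        then show ?thesis using e by (simp add: field_simps)
      qed
      from this[OF that(1)] this[OF that(2)] have "(norm (s m - s n))\<^sup>2 < e\<^sup>2" using par[of m n]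
          by linarith
      then show ?thesis using e by (simp add: dist_norm power2_less_imp_less)
    qed
    then show "\<exists>M. \<forall>m\<ge>M. \<forall>n\<ge>M. dist (s m) (s n) < e" by blast
  qed
  then obtain p where p: "s \<longlonglongrightarrow> p" using Cauchy_convergent_iff convergent_def by blast
  have pS: "p \<in> S" using closed_sequentially[OF assms(2)] s(1) p by blast
  have min: "(norm (x - p))\<^sup>2 \<le> (norm (x - h))\<^sup>2" if "h \<in> S" for h
  proof -
    have "(norm (x - p))\<^sup>2 \<le> d"
    proof (rule LIMSEQ_le)
      show "(\<lambda>n. (norm (x - s n))\<^sup>2) \<longlonglongrightarrow> (norm (x - p))\<^sup>2" by (intro tendsto_intros p)
      show "(\<lambda>n. d + 1 / real (Suc n)) \<longlonglongrightarrow> d"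
        using tendsto_add[OF tendsto_const LIMSEQ_inverse_real_of_nat, of d]
            by (simp add: inverse_eq_divide)
      show "\<exists>N. \<forall>n\<ge>N. (norm (x - s n))\<^sup>2 \<le> d + 1 / real (Suc n)" using s(2) less_imp_le by blast
    qed
    then show ?thesis using dle[OF that] by linarith
  qed
  have "(x - p) \<bullet> h = 0" if h: "h \<in> S" for h
  proof (cases "h = 0")
    case False
    \<comment> \<open>Among all \<open>p + t h\<close>, this \<open>t\<close> gives the point closest to \<open>x\<close>.\<close>
    define t where "t = (x - p) \<bullet> h / (h \<bullet> h)"
    have hh: "h \<bullet> h > 0" using False by simp
    have "p + t *\<^sub>R h \<in> S" using pS h assms(1) by (simp add: subspace_add subspace_scale)
    moreover have "x - (p + t *\<^sub>R h) = x - p - t *\<^sub>R h" by simp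
    ultimately have "(x - p) \<bullet> (x - p) \<le> (x - p - t *\<^sub>R h) \<bullet> (x - p - t *\<^sub>R h)"
      using min[of "p + t *\<^sub>R h"] by (simp only: power2_norm_eq_inner)
    also have "\<dots> = (x - p) \<bullet> (x - p) - 2 * t * ((x - p) \<bullet> h) + t * t * (h \<bullet> h)"
    proof -
      have "(u - t *\<^sub>R h) \<bullet> (u - t *\<^sub>R h) = u \<bullet> u - 2 * t * (u \<bullet> h) + t * t * (h \<bullet> h)" for u
        using inner_commute[of h u] by (simp add: inner_diff_left inner_diff_right algebra_simps)
      then show ?thesis .
    qed
    also have "t * t * (h \<bullet> h) = t * ((x - p) \<bullet> h)" using hh by (simp add: t_def)
    finally have "t * ((x - p) \<bullet> h) \<le> 0" by simp
    then have "((x - p) \<bullet> h)\<^sup>2 \<le> 0" using hh by (simp add: t_def power2_eq_square divide_le_0_iff)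
    then show ?thesis by simp
  qed simp
  with pS show ?thesis by blast
qed

lemma orthogonal_projection_unique:
  fixes S :: "'a::real_inner set"
  assumes "subspace S" "p \<in> S" "\<forall>h\<in>S. (x - p) \<bullet> h = 0" "q \<in> S" "\<forall>h\<in>S. (x - q) \<bullet> h = 0"
  shows "p = q"
proof -
  have "q - p \<in> S" using assms by (simp add: subspace_diff)
  then have "(x - p) \<bullet> (q - p) - (x - q) \<bullet> (q - p) = 0" using assms by simp
  then have "(q - p) \<bullet> (q - p) = 0" by (simp flip: inner_diff_left)
  then show ?thesis by simp
qed

locale linear_isometry =
  fixes V :: "'a::{real_inner, complete_space} \<Rightarrow> 'a"
  assumes linear: "linear V" and norm_eq: "norm (V f) = norm f"
begin

lemma inner_eq: "V f \<bullet> V g = f \<bullet> g"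
proof -
  have "(norm (V (f + g)))\<^sup>2 = (norm (f + g))\<^sup>2" by (simp add: norm_eq)
  then show ?thesis
    by (simp add: linear_add[OF linear] power2_norm_eq_inner inner_add_left inner_add_right
        inner_commute)
       (simp add: norm_eq flip: power2_norm_eq_inner)
qed

lemma subspace_range: "subspace (range V)"
  using linear_subspace_image[OF linear subspace_UNIV] by simp

lemma closed_range: "closed (range V)"
proof (rule complete_imp_closed, rule completeI)
  fix s assume s: "\<forall>n. s n \<in> range V" "Cauchy s"
  then have "\<forall>n. \<exists>v. s n = V v" by blast
  from choice[OF this] obtain u where u: "\<And>n. s n = V (u n)" by blast
  have "Cauchy u"
    using s(2) unfolding Cauchy_def u dist_norm linear_diff[OF linear, symmetric] norm_eq .
  then obtain l where l: "u \<longlonglongrightarrow> l" using Cauchy_convergent_iff convergent_def by blast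
  have "s \<longlonglongrightarrow> V l"
    using l unfolding tendsto_iff u dist_norm linear_diff[OF linear, symmetric] norm_eq .
  then show "\<exists>l\<in>range V. s \<longlonglongrightarrow> l" by blast
qed

text \<open>The orthogonal complement of the range. For the multiplication by an inner function this is
the model space.\<close>
definition cokernel where "cokernel = {f. \<forall>g. f \<bullet> V g = 0}"

lemma subspace_cokernel: "subspace cokernel"
  by (auto simp: subspace_def cokernel_def inner_add_left)

lemma closed_cokernel: "closed cokernel"
  unfolding cokernel_def by (intro closed_Collect_all closed_Collect_eq continuous_intros)

text \<open>The range of an isometry of a complete space is complete, so every vector can be projected
onto it.\<close>
lemma decompose: obtains q k where "q \<in> cokernel" "f = q + V k"
proof -
  obtain p where "p \<in> range V" "\<forall>h\<in>range V. (f - p) \<bullet> h = 0"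
    using orthogonal_projection_exists[OF subspace_range closed_range] by blast
  then obtain k where "f - V k \<in> cokernel" by (auto simp: cokernel_def)
  then show ?thesis using that[of "f - V k" k] by simp
qed

text \<open>The orthogonal projection onto the cokernel. It is chosen through the decomposition along
the range, because the component \<open>V k\<close> is what the kernel and the norm of a compression are read
off from.\<close>
definition proj :: "'a \<Rightarrow> 'a" where
  "proj f = (SOME q. q \<in> cokernel \<and> (\<exists>k. f = q + V k))"

lemma proj: "proj f \<in> cokernel" "\<exists>k. f = proj f + V k"
proof -
  have "\<exists>q. q \<in> cokernel \<and> (\<exists>k. f = q + V k)" using decompose[of f] by metis
  from someI_ex[OF this] show "proj f \<in> cokernel" "\<exists>k. f = proj f + V k" by (auto simp: proj_def)
qed

lemma proj_orthogonal:
  assumes "h \<in> cokernel"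
  shows "(f - proj f) \<bullet> h = 0"
proof -
  obtain k where "f = proj f + V k" using proj(2) by blast
  then have "f - proj f = V k" by (metis add_diff_cancel_left')
  then show ?thesis using assms by (simp add: cokernel_def inner_commute)
qed

lemma proj_eqI: "q \<in> cokernel \<Longrightarrow> proj (q + V k) = q"
  by (rule orthogonal_projection_unique[OF subspace_cokernel proj(1), of "q + V k"])
     (simp_all add: proj_orthogonal, simp add: cokernel_def inner_commute)

lemma norm_proj: "f = proj f + V k \<Longrightarrow> (norm f)\<^sup>2 = (norm (proj f))\<^sup>2 + (norm k)\<^sup>2"
proof -
  assume f: "f = proj f + V k"
  have "proj f \<bullet> V k = 0" using proj(1)[of f] by (simp add: cokernel_def)
  then show ?thesis
    by (subst f) (simp add: power2_norm_eq_inner inner_add_left inner_add_right inner_commute inner_eq)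
qed

lemma norm_proj_le: "norm (proj f) \<le> norm f"
proof -
  obtain k where "f = proj f + V k" using proj(2) by blast
  from norm_proj[OF this] have "(norm (proj f))\<^sup>2 \<le> (norm f)\<^sup>2" by simp
  then show ?thesis by (rule power2_le_imp_le) simp
qed

lemma norm_proj_eq_iff: "norm (proj f) = norm f \<longleftrightarrow> f \<in> cokernel"
proof
  obtain k where k: "f = proj f + V k" using proj(2) by blast
  assume "norm (proj f) = norm f"
  with norm_proj[OF k] have "k = 0" by simp
  then have "V k = 0" by (simp add: linear_0[OF linear])
  with k proj(1)[of f] show "f \<in> cokernel" by (metis add_0_right)
next
  assume "f \<in> cokernel"
  from proj_eqI[OF this, of 0] show "norm (proj f) = norm f" by (simp add: linear_0[OF linear])
qed

lemma proj_eq_0_iff: "proj f = 0 \<longleftrightarrow> f \<in> range V"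
proof
  show "f \<in> range V" if "proj f = 0" using proj(2)[of f] that by (metis add_0 rangeI)
  show "proj f = 0" if "f \<in> range V"
    using that proj_eqI[of 0] subspace_0[OF subspace_cokernel] by force
qed

lemma linear_proj: "linear proj"
proof (rule linearI)
  fix f g :: 'a and c :: real
  obtain k l where k: "f = proj f + V k" and l: "g = proj g + V l" using proj(2) by meson
  have "f + g = (proj f + proj g) + V (k + l)"
    by (subst k, subst l) (simp add: linear_add[OF linear])
  then show "proj (f + g) = proj f + proj g"
    using proj_eqI[of "proj f + proj g" "k + l"] proj(1) subspace_add[OF subspace_cokernel] by metis
  have "c *\<^sub>R f = c *\<^sub>R proj f + V (c *\<^sub>R k)"
    by (subst k) (simp add: linear_scale[OF linear] scaleR_add_right)
  then show "proj (c *\<^sub>R f) = c *\<^sub>R proj f"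
    using proj_eqI[of "c *\<^sub>R proj f" "c *\<^sub>R k"] proj(1) subspace_scale[OF subspace_cokernel] by metis
qed

end

text \<open>The kernel of the compression \<open>f \<mapsto> P (W f)\<close> to the cokernel of \<open>V\<close>, where \<open>P\<close> is the
projection onto that cokernel: \<open>P\<close> annihilates exactly the range of \<open>V\<close>.\<close>
definition compression_kernel where
  "compression_kernel V W = {f \<in> linear_isometry.cokernel V. W f \<in> range V}"

text \<open>For an isometry \<open>W\<close> this says that the compression of \<open>W\<close> to the cokernel of \<open>V\<close> preserves
norms on the orthogonal complement of its kernel, since \<open>\<parallel>P (W f)\<parallel> = \<parallel>W f\<parallel>\<close> holds only if \<open>W f\<close>
already lies in the cokernel.\<close>
definition compression_partial_isometry where
  "compression_partial_isometry V W \<longleftrightarrow>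
     (\<forall>f\<in>linear_isometry.cokernel V. (\<forall>g\<in>compression_kernel V W. f \<bullet> g = 0) \<longrightarrow>
         W f \<in> linear_isometry.cokernel V)"

text \<open>Take \<open>g\<close> in the cokernel of \<open>W\<close>, orthogonal to the kernel for the exchanged pair, and show
that \<open>V g\<close> is orthogonal to every \<open>W h\<close>. Split \<open>h = b + a + V k\<close> with \<open>a\<close> in the kernel \<open>N\<close> and
\<open>b\<close> in the cokernel of \<open>V\<close>, orthogonal to \<open>N\<close>. The part \<open>W b\<close> lies in the cokernel of \<open>V\<close> by
hypothesis. The part \<open>W (V k) = V (W k)\<close> contributes \<open>g \<bullet> W k = 0\<close>. Finally \<open>W a = V c\<close> for some
\<open>c\<close>, this \<open>c\<close> lies in the kernel for the exchanged pair, and \<open>V g \<bullet> V c = g \<bullet> c = 0\<close>.\<close>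
lemma compression_partial_isometry_swap:
  assumes "linear_isometry V" "linear_isometry W" and comm: "\<And>f. V (W f) = W (V f)"
    and VW: "compression_partial_isometry V W"
  shows "compression_partial_isometry W V"
proof -
  interpret V: linear_isometry V by fact
  interpret W: linear_isometry W by fact
  let ?N = "compression_kernel V W"
  have N: "?N = V.cokernel \<inter> W -` range V"
    by (auto simp: compression_kernel_def)
  have "subspace ?N"
    unfolding N by (intro subspace_inter V.subspace_cokernel linear_subspace_vimage W.linear
        V.subspace_range)
  moreover have "closed ?N"
  proof -
    have "continuous_on UNIV W"
      by (rule linear_continuous_on) (auto intro!: bounded_linear_intro[where K = 1]
          simp: W.norm_eq linear_add[OF W.linear] linear_scale[OF W.linear])
    then show ?thesis
      unfolding N by (intro closed_Int V.closed_cokernel closed_vimage V.closed_range)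
  qed
  note proj = orthogonal_projection_exists[OF calculation this]
  show ?thesis
    unfolding compression_partial_isometry_def
  proof (intro ballI impI)
    fix g assume g: "g \<in> W.cokernel" and gN: "\<forall>f\<in>compression_kernel W V. g \<bullet> f = 0"
    have "V g \<bullet> W h = 0" for h
    proof -
      \<comment> \<open>The summand \<open>b\<close> of the splitting above is \<open>q - a\<close>.\<close>
      obtain q k where q: "q \<in> V.cokernel" "h = q + V k" by (rule V.decompose)
      obtain a where a: "a \<in> ?N" "\<forall>h\<in>?N. (q - a) \<bullet> h = 0" using proj by blast
      have "V g \<bullet> W (V k) = 0"
        using g by (simp add: V.inner_eq W.cokernel_def flip: comm)
      moreover have "V g \<bullet> W (q - a) = 0"
      proof -
        have "q - a \<in> V.cokernel" using q a by (auto simp: N intro: subspace_diff V.subspace_cokernel)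
        then have "W (q - a) \<in> V.cokernel"
          using VW a(2) by (auto simp: compression_partial_isometry_def)
        then show ?thesis by (simp add: V.cokernel_def inner_commute)
      qed
      moreover have "V g \<bullet> W a = 0"
      proof -
        obtain c where c: "W a = V c" using a by (auto simp: N)
        have "c \<bullet> W k = 0" for k
        proof -
          have "c \<bullet> W k = V c \<bullet> V (W k)" by (simp add: V.inner_eq)
          also have "\<dots> = a \<bullet> V k" by (simp add: comm W.inner_eq flip: c)
          also have "\<dots> = 0" using a by (simp add: N V.cokernel_def)
          finally show ?thesis .
        qed
        then have "c \<in> compression_kernel W V"
          unfolding compression_kernel_def W.cokernel_def using c by (auto simp flip: c)
        then show ?thesis using gN by (simp add: c V.inner_eq)
      qed
      ultimately show ?thesis
        by (simp add: q linear_add[OF W.linear] linear_diff[OF W.linear] inner_add_right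
            inner_diff_right)
    qed
    then show "V g \<in> W.cokernel" by (simp add: W.cokernel_def)
  qed
qed

section \<open>Rotation invariance on the circle and on the torus\<close>

lemma sets_circle_measure [measurable_cong, simp]: "sets circle_measure = sets borel"
  by (simp add: circle_measure_def)

lemma space_circle_measure [simp]: "space circle_measure = UNIV"
  by (simp add: circle_measure_def)

lemma measurable_cis [measurable]: "cis \<in> borel_measurable borel"
  by (intro borel_measurable_continuous_onI continuous_intros)

lemma prob_space_circle_measure: "prob_space circle_measure"
  unfolding circle_measure_def
proof (rule prob_space.prob_space_distr)
  show "prob_space (uniform_measure lborel {0..<2 * pi})"
    by (rule prob_space_uniform_measure) auto
qed simp

interpretation circle: prob_space circle_measure
  by (rule prob_space_circle_measure)

lemma nn_integral_circle_measure:
  assumes [measurable]: "g \<in> borel_measurable borel"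
  shows "(\<integral>\<^sup>+\<zeta>. g \<zeta> \<partial>circle_measure) =
         (\<integral>\<^sup>+t. g (cis t) * indicator {0..<2 * pi} t \<partial>lborel) / ennreal (2 * pi)"
  unfolding circle_measure_def
  by (simp add: nn_integral_distr nn_integral_uniform_measure)

text \<open>The part of \<open>{a..<a + p}\<close> beyond \<open>p\<close> is moved back to \<open>{0..<a}\<close> by periodicity.\<close>
lemma nn_integral_period_shift:
  fixes G :: "real \<Rightarrow> ennreal"
  assumes [measurable]: "G \<in> borel_measurable borel"
    and per: "\<And>t. G (t + p) = G t" and a: "0 \<le> a" "a \<le> p"
  shows "(\<integral>\<^sup>+t. G (a + t) * indicator {0..<p} t \<partial>lborel) = (\<integral>\<^sup>+t. G t * indicator {0..<p} t \<partial>lborel)"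
proof -
  have "(\<integral>\<^sup>+t. G t * indicator {a..<a + p} t \<partial>lborel) =
        (\<integral>\<^sup>+t. G (a + t) * indicator {a..<a + p} (a + t) \<partial>lborel)"
    by (subst nn_integral_real_affine[where c = 1 and t = a]) auto
  also have "\<dots> = (\<integral>\<^sup>+t. G (a + t) * indicator {0..<p} t \<partial>lborel)"
    by (intro nn_integral_cong) (auto simp: indicator_def)
  finally have 1: "(\<integral>\<^sup>+t. G (a + t) * indicator {0..<p} t \<partial>lborel) =
      (\<integral>\<^sup>+t. G t * indicator {a..<a + p} t \<partial>lborel)" by simp
  have 2: "(\<integral>\<^sup>+t. G t * indicator {p..<a + p} t \<partial>lborel) = (\<integral>\<^sup>+t. G t * indicator {0..<a} t \<partial>lborel)"
  proof -
    have "(\<integral>\<^sup>+t. G t * indicator {p..<a + p} t \<partial>lborel) =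
        (\<integral>\<^sup>+t. G (p + t) * indicator {p..<a + p} (p + t) \<partial>lborel)"
      by (subst nn_integral_real_affine[where c = 1 and t = p]) auto
    also have "\<dots> = (\<integral>\<^sup>+t. G t * indicator {0..<a} t \<partial>lborel)"
      using per by (intro nn_integral_cong) (auto simp: indicator_def add.commute)
    finally show ?thesis .
  qed
  have "(\<integral>\<^sup>+t. G t * indicator {a..<a + p} t \<partial>lborel) =
      (\<integral>\<^sup>+t. G t * indicator {a..<p} t + G t * indicator {p..<a + p} t \<partial>lborel)"
    using a by (intro nn_integral_cong) (auto simp: indicator_def)
  also have "\<dots> = (\<integral>\<^sup>+t. G t * indicator {a..<p} t \<partial>lborel) + (\<integral>\<^sup>+t. G t * indicator {0..<a} t \<partial>lborel)"
    by (simp add: nn_integral_add 2)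
  also have "\<dots> = (\<integral>\<^sup>+t. G t * indicator {a..<p} t + G t * indicator {0..<a} t \<partial>lborel)"
    by (simp add: nn_integral_add)
  also have "\<dots> = (\<integral>\<^sup>+t. G t * indicator {0..<p} t \<partial>lborel)"
    using a by (intro nn_integral_cong) (auto simp: indicator_def)
  finally show ?thesis using 1 by simp
qed

lemma circle_measure_rotation:
  assumes "cmod u = 1"
  shows "distr circle_measure borel (\<lambda>\<zeta>. u * \<zeta>) = circle_measure"
proof (rule measure_eqI)
  fix A assume "A \<in> sets (distr circle_measure borel ((*) u))"
  then have [measurable]: "A \<in> sets borel" by simp
  define a where "a = Arg2pi u"
  have u: "u = cis a"
    using assms Arg2pi_eq[of u] by (simp add: a_def cis_conv_exp)
  have a: "0 \<le> a" "a \<le> 2 * pi"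
    using Arg2pi[of u] by (auto simp: a_def)
  define G :: "real \<Rightarrow> ennreal" where "G = (\<lambda>t. indicator A (cis t))"
  have [measurable]: "G \<in> borel_measurable borel" by (simp add: G_def)
  have "emeasure (distr circle_measure borel ((*) u)) A = (\<integral>\<^sup>+\<zeta>. indicator A (u * \<zeta>) \<partial>circle_measure)"
    by (simp add: nn_integral_distr flip: nn_integral_indicator)
  also have "\<dots> = (\<integral>\<^sup>+t. G (a + t) * indicator {0..<2 * pi} t \<partial>lborel) / ennreal (2 * pi)"
    by (subst nn_integral_circle_measure) (auto simp: G_def u cis_mult)
  also have "\<dots> = (\<integral>\<^sup>+t. G t * indicator {0..<2 * pi} t \<partial>lborel) / ennreal (2 * pi)"
    by (subst nn_integral_period_shift) (use a in \<open>auto simp: G_def simp flip: cis_mult\<close>)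
  also have "\<dots> = emeasure circle_measure A"
    by (simp add: G_def nn_integral_circle_measure flip: nn_integral_indicator)
  finally show "emeasure (distr circle_measure borel ((*) u)) A = emeasure circle_measure A" .
qed simp

lemma AE_circle_measure: "AE \<zeta> in circle_measure. cmod \<zeta> = 1"
  unfolding circle_measure_def by (subst AE_distr_iff) auto

lemma measurable_vec_lambda_PiM:
  "(\<lambda>x. \<chi> i. x i) \<in> measurable (PiM UNIV (\<lambda>_. circle_measure)) (borel :: (complex ^ 'n::finite)
      measure)"
  by (subst borel_measurable_euclidean_space) (auto simp: Basis_vec_def inner_axis)

lemma sets_torus_measure [measurable_cong, simp]: "sets torus_measure = sets borel"
  by (simp add: torus_measure_def)

lemma space_torus_measure [simp]: "space torus_measure = UNIV"
  by (simp add: torus_measure_def)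

lemma prob_space_torus_measure: "prob_space torus_measure"
  unfolding torus_measure_def
  by (intro prob_space.prob_space_distr prob_space_PiM prob_space_circle_measure
      measurable_vec_lambda_PiM)

interpretation torus: prob_space torus_measure
  by (rule prob_space_torus_measure)

definition torus :: "(complex ^ 'n::finite) set" where
  "torus = {z. \<forall>i. cmod (z $ i) = 1}"

lemma AE_torus_measure: "AE z in torus_measure. z \<in> torus"
proof -
  interpret product_prob_space "\<lambda>_::'a. circle_measure"
    by (intro product_prob_spaceI prob_space_circle_measure)
  have "AE x in PiM UNIV (\<lambda>_::'a. circle_measure). \<forall>i\<in>UNIV. cmod (x i) = 1"
    by (intro AE_finite_allI AE_PiM_component prob_space_circle_measure) (auto simp: AE_circle_measure)
  moreover have "closed (torus :: (complex ^ 'a) set)"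
    unfolding torus_def by (intro closed_Collect_all closed_Collect_eq continuous_intros)
  ultimately show ?thesis
    unfolding torus_measure_def by (subst AE_distr_iff) (auto simp: torus_def measurable_vec_lambda_PiM)
qed

text \<open>The torus acts on the whole space by coordinatewise multiplication.\<close>
definition vmult :: "complex ^ 'n::finite \<Rightarrow> complex ^ 'n \<Rightarrow> complex ^ 'n" where
  "vmult u z = (\<chi> i. u $ i * z $ i)"

lemma continuous_on_vmult [continuous_intros]:
  "continuous_on S f \<Longrightarrow> continuous_on S g \<Longrightarrow> continuous_on S (\<lambda>x. vmult (f x) (g x))"
  unfolding vmult_def by (intro continuous_intros)

text \<open>The preimage of a measurable box under a coordinatewise rotation is a box again, and each of
its sides keeps its measure.\<close>
lemma torus_measure_rotation:
  fixes u :: "complex ^ 'n::finite"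
  assumes u: "u \<in> torus"
  shows "distr torus_measure borel (vmult u) = torus_measure"
proof -
  let ?M = "\<lambda>_::'n. circle_measure"
  interpret product_prob_space ?M
    by (intro product_prob_spaceI prob_space_circle_measure)
  let ?R = "\<lambda>x i. u $ i * x i"
  have R [measurable]: "?R \<in> measurable (PiM UNIV ?M) (PiM UNIV ?M)"
    by (rule measurable_PiM_single') auto
  have "distr (PiM UNIV ?M) (PiM UNIV ?M) ?R = PiM UNIV ?M"
  proof (rule PiM_eqI)
    fix A :: "'n \<Rightarrow> complex set" assume A: "\<And>i. i \<in> UNIV \<Longrightarrow> A i \<in> sets circle_measure"
    have [measurable]: "A i \<in> sets borel" for i using A by simp
    have m [measurable]: "(*) (u $ i) -` A i \<in> sets circle_measure" for i
      using measurable_sets[of "(*) (u $ i)" borel borel "A i"] by simp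
    have "emeasure (distr (PiM UNIV ?M) (PiM UNIV ?M) ?R) (Pi\<^sub>E UNIV A) =
        emeasure (PiM UNIV ?M) (Pi\<^sub>E UNIV (\<lambda>i. (*) (u $ i) -` A i))"
    proof (subst emeasure_distr)
      show "Pi\<^sub>E UNIV A \<in> sets (PiM UNIV ?M)" by (rule sets_PiM_I_finite) auto
    qed (auto intro!: arg_cong2[where f = emeasure] simp: space_PiM PiE_def Pi_def)
    also have "\<dots> = (\<Prod>i\<in>UNIV. emeasure circle_measure ((*) (u $ i) -` A i))"
      using m by (subst emeasure_PiM) auto
    also have "\<dots> = (\<Prod>i\<in>UNIV. emeasure (distr circle_measure borel ((*) (u $ i))) (A i))"
      by (subst emeasure_distr) auto
    also have "\<dots> = (\<Prod>i\<in>UNIV. emeasure circle_measure (A i))"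
      using u by (simp add: circle_measure_rotation torus_def)
    finally show "emeasure (distr (PiM UNIV ?M) (PiM UNIV ?M) ?R) (Pi\<^sub>E UNIV A) =
        (\<Prod>i\<in>UNIV. emeasure circle_measure (A i))" .
  qed auto
  then have "torus_measure = distr (distr (PiM UNIV ?M) (PiM UNIV ?M) ?R) borel (\<lambda>x. \<chi> i. x i)"
    by (simp add: torus_measure_def)
  also have "\<dots> = distr (PiM UNIV ?M) borel ((\<lambda>x. \<chi> i. x i) \<circ> ?R)"
    by (intro distr_distr R measurable_vec_lambda_PiM)
  also have "\<dots> = distr (PiM UNIV ?M) borel (vmult u \<circ> (\<lambda>x. \<chi> i. x i))"
    by (simp add: vmult_def comp_def)
  also have "\<dots> = distr torus_measure borel (vmult u)"
    unfolding torus_measure_def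
    by (subst distr_distr)
       (auto simp: measurable_vec_lambda_PiM intro!: borel_measurable_continuous_onI continuous_intros)
  finally show ?thesis by simp
qed

text \<open>A single unimodular number acts on the coordinates in \<open>S\<close> only. Rotating all coordinates
sweeps out a circle on the slice through the origin, rotating one coordinate a circle on a
coordinate slice.\<close>
definition rot :: "'n::finite set \<Rightarrow> complex \<Rightarrow> complex ^ 'n \<Rightarrow> complex ^ 'n" where
  "rot S \<zeta> z = (\<chi> i. if i \<in> S then \<zeta> * z $ i else z $ i)"

lemma continuous_on_rot [continuous_intros]:
  fixes h :: "'a::topological_space \<Rightarrow> complex ^ 'n::finite"
  assumes "continuous_on A g" "continuous_on A h"
  shows "continuous_on A (\<lambda>x. rot S (g x) (h x))"
  unfolding rot_def
proof (intro continuous_on_vec_lambda)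
  fix i show "continuous_on A (\<lambda>x. if i \<in> S then g x * h x $ i else h x $ i)"
    using assms by (cases "i \<in> S") (auto intro!: continuous_intros)
qed

text \<open>By Tonelli's theorem the two integrals may be exchanged, and for each fixed \<open>\<zeta>\<close> of modulus
one the rotation preserves the measure of the torus.\<close>
lemma nn_integral_torus_rot:
  fixes G :: "complex ^ 'n::finite \<Rightarrow> ennreal"
  assumes [measurable]: "G \<in> borel_measurable borel"
  shows "(\<integral>\<^sup>+z. G z \<partial>torus_measure) = (\<integral>\<^sup>+z. (\<integral>\<^sup>+\<zeta>. G (rot S \<zeta> z) \<partial>circle_measure) \<partial>torus_measure)"
proof -
  interpret P: pair_sigma_finite circle_measure "torus_measure :: (complex ^ 'n) measure"
    by unfold_locales
  have m: "(\<lambda>p. rot S (fst p) (snd p)) \<in> borel_measurable (borel \<Otimes>\<^sub>M (borel :: (complex ^ 'n) measure))"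
    unfolding borel_prod by (intro borel_measurable_continuous_onI continuous_intros)
  have m' [measurable]: "(\<lambda>(\<zeta>, z). G (rot S \<zeta> z)) \<in> borel_measurable (circle_measure \<Otimes>\<^sub>M
      (torus_measure :: (complex ^ 'n) measure))"
    using measurable_compose[OF m assms] by (simp add: case_prod_unfold cong: measurable_cong_sets)
  have "(\<integral>\<^sup>+z. (\<integral>\<^sup>+\<zeta>. G (rot S \<zeta> z) \<partial>circle_measure) \<partial>torus_measure) =
        (\<integral>\<^sup>+\<zeta>. (\<integral>\<^sup>+z. G (rot S \<zeta> z) \<partial>torus_measure) \<partial>circle_measure)"
    by (rule P.Fubini'[OF m'])
  also have "\<dots> = (\<integral>\<^sup>+\<zeta>. (\<integral>\<^sup>+z. G z \<partial>torus_measure) \<partial>circle_measure)"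
  proof (rule nn_integral_cong_AE, use AE_circle_measure in eventually_elim)
    fix \<zeta> :: complex assume "cmod \<zeta> = 1"
    define u :: "complex ^ 'n" where "u = (\<chi> i. if i \<in> S then \<zeta> else 1)"
    have u: "u \<in> torus" "rot S \<zeta> = vmult u"
      using \<open>cmod \<zeta> = 1\<close> by (auto simp: torus_def u_def rot_def vmult_def fun_eq_iff vec_eq_iff)
    have [measurable]: "vmult u \<in> borel_measurable borel"
      by (intro borel_measurable_continuous_onI continuous_intros)
    have "(\<integral>\<^sup>+z. G z \<partial>torus_measure) = (\<integral>\<^sup>+z. G z \<partial>distr torus_measure borel (vmult u))"
      by (simp add: torus_measure_rotation u)
    then show "(\<integral>\<^sup>+z. G (rot S \<zeta> z) \<partial>torus_measure) = (\<integral>\<^sup>+z. G z \<partial>torus_measure)"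
      by (simp add: nn_integral_distr u)
  qed
  also have "\<dots> = (\<integral>\<^sup>+z. G z \<partial>torus_measure)"
    using circle.emeasure_space_1 by simp
  finally show ?thesis by simp
qed

section \<open>Power series on circles\<close>

lemma measurable_cnj [measurable]: "cnj \<in> borel_measurable borel"
  by (intro borel_measurable_continuous_onI continuous_intros)

lemma borel_measurable_circle_measure [simp]: "borel_measurable circle_measure = borel_measurable borel"
  by (rule measurable_cong_sets) auto

lemma borel_measurable_torus_measure [simp]: "borel_measurable torus_measure = borel_measurable borel"
  by (rule measurable_cong_sets) auto

lemma circle_integrable_bounded:
  fixes h :: "complex \<Rightarrow> 'b::{banach, second_countable_topology}"
  assumes "h \<in> borel_measurable borel" "\<And>\<zeta>. cmod \<zeta> = 1 \<Longrightarrow> norm (h \<zeta>) \<le> B"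
  shows "integrable circle_measure h"
proof (rule circle.integrable_const_bound)
  show "AE \<zeta> in circle_measure. norm (h \<zeta>) \<le> B"
    using AE_circle_measure by eventually_elim (use assms in auto)
qed (use assms in simp)

lemma circle_integral_rotation:
  fixes h :: "complex \<Rightarrow> complex"
  assumes [measurable]: "h \<in> borel_measurable borel" and "cmod u = 1"
  shows "(LINT \<zeta>|circle_measure. h (u * \<zeta>)) = (LINT \<zeta>|circle_measure. h \<zeta>)"
proof -
  have "(LINT \<zeta>|circle_measure. h \<zeta>) = (LINT \<zeta>|distr circle_measure borel ((*) u). h \<zeta>)"
    using assms by (simp add: circle_measure_rotation)
  then show ?thesis by (simp add: integral_distr)
qed

text \<open>For \<open>j \<noteq> k\<close> the rotation by the angle \<open>\<pi> / (j - k)\<close> turns the integrand into its negative.\<close>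
lemma circle_integral_monomial:
  "(LINT \<zeta>|circle_measure. \<zeta> ^ j * cnj \<zeta> ^ k) = (if j = k then 1 else 0)"
proof (cases "j = k")
  case True
  have "(LINT \<zeta>|circle_measure. \<zeta> ^ j * cnj \<zeta> ^ k) = (LINT \<zeta>|circle_measure. 1)"
  proof (rule integral_cong_AE)
    show "AE \<zeta> in circle_measure. \<zeta> ^ j * cnj \<zeta> ^ k = 1"
      using AE_circle_measure by eventually_elim
        (auto simp: True complex_norm_square[symmetric] simp flip: power_mult_distrib)
  qed auto
  then show ?thesis using True circle.prob_space by simp
next
  case False
  define x where "x = pi / (real j - real k)"
  define u where "u = cis x"
  have "real j * x - real k * x = pi"
    using False by (subst left_diff_distrib[symmetric]) (simp add: x_def)
  then have u: "u ^ j * cnj u ^ k = -1"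
    by (simp add: u_def cis_cnj Complex.DeMoivre cis_mult)
  let ?I = "LINT \<zeta>|circle_measure. \<zeta> ^ j * cnj \<zeta> ^ k"
  have "?I = (LINT \<zeta>|circle_measure. (u * \<zeta>) ^ j * cnj (u * \<zeta>) ^ k)"
    by (rule circle_integral_rotation[symmetric])
      (auto simp: u_def intro!: borel_measurable_continuous_onI continuous_intros)
  also have "\<dots> = (LINT \<zeta>|circle_measure. (u ^ j * cnj u ^ k) * (\<zeta> ^ j * cnj \<zeta> ^ k))"
    by (simp add: power_mult_distrib mult_ac)
  also have "\<dots> = - ?I" by (simp add: u)
  finally show ?thesis using False by simp
qed

context
  fixes g :: "complex \<Rightarrow> complex" and a :: "nat \<Rightarrow> complex"
  assumes g [measurable]: "g \<in> borel_measurable borel"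
    and sums: "\<And>\<zeta>. cmod \<zeta> = 1 \<Longrightarrow> (\<lambda>k. a k * \<zeta> ^ k) sums g \<zeta>"
    and abs: "summable (\<lambda>k. cmod (a k))"
begin

lemma partial_sum_bound:
  assumes "cmod \<zeta> = 1"
  shows "cmod (\<Sum>k<N. a k * \<zeta> ^ k) \<le> (\<Sum>k. cmod (a k))"
proof -
  have "cmod (\<Sum>k<N. a k * \<zeta> ^ k) \<le> (\<Sum>k<N. cmod (a k))"
    by (rule sum_norm_le) (simp add: assms norm_mult norm_power)
  also have "\<dots> \<le> (\<Sum>k. cmod (a k))"
    by (rule sum_le_suminf[OF abs]) auto
  finally show ?thesis .
qed

text \<open>Absolute summability bounds all partial sums on the circle by one constant, so dominated
convergence applies to any continuous expression \<open>F\<close> in the variable and the partial sum. It is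
used with \<open>F\<close> picking out a coefficient and with the squared modulus.\<close>
lemma circle_partial_sum_tendsto:
  fixes F :: "complex \<Rightarrow> complex \<Rightarrow> 'b::{banach, second_countable_topology}"
  assumes F: "continuous_on UNIV (\<lambda>p. F (fst p) (snd p))"
  shows "(\<lambda>N. LINT \<zeta>|circle_measure. F \<zeta> (\<Sum>k<N. a k * \<zeta> ^ k)) \<longlonglongrightarrow> (LINT \<zeta>|circle_measure. F \<zeta> (g \<zeta>))"
proof -
  let ?M = "\<Sum>k. cmod (a k)"
  have Fm: "(\<lambda>p. F (fst p) (snd p)) \<in> borel_measurable (borel \<Otimes>\<^sub>M borel)"
    unfolding borel_prod by (rule borel_measurable_continuous_onI[OF F])
  have Fc: "(\<lambda>\<zeta>. F \<zeta> (h \<zeta>)) \<in> borel_measurable borel" if [measurable]: "h \<in> borel_measurable borel"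
      for h
    using measurable_compose[OF measurable_Pair[OF measurable_ident_sets[OF refl] that] Fm] by simp
  have "compact ((\<lambda>p. F (fst p) (snd p)) ` (sphere 0 1 \<times> cball 0 ?M))"
    by (intro compact_continuous_image continuous_on_subset[OF F] compact_Times) auto
  then obtain B where B: "\<And>x. x \<in> (\<lambda>p. F (fst p) (snd p)) ` (sphere 0 1 \<times> cball 0 ?M) \<Longrightarrow> norm x \<le> B"
    by (meson compact_imp_bounded bounded_iff)
  show ?thesis
  proof (rule integral_dominated_convergence[where w = "\<lambda>_. B"])
    show "AE \<zeta> in circle_measure. (\<lambda>N. F \<zeta> (\<Sum>k<N. a k * \<zeta> ^ k)) \<longlonglongrightarrow> F \<zeta> (g \<zeta>)"
      using AE_circle_measure
    proof eventually_elim
      case (elim \<zeta>)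
      have "isCont (\<lambda>p. F (fst p) (snd p)) (\<zeta>, g \<zeta>)"
        using F by (simp add: continuous_on_eq_continuous_at)
      from isCont_tendsto_compose[OF this tendsto_Pair[OF tendsto_const sums[OF elim, unfolded
          sums_def]]]
      show ?case by simp
    qed
    show "AE \<zeta> in circle_measure. norm (F \<zeta> (\<Sum>k<N. a k * \<zeta> ^ k)) \<le> B" for N
      using AE_circle_measure
    proof eventually_elim
      case (elim \<zeta>)
      show ?case using partial_sum_bound[OF elim, of N] elim by (intro B) force
    qed
  qed (auto intro!: Fc)
qed

lemma circle_coefficient: "(LINT \<zeta>|circle_measure. g \<zeta> * cnj \<zeta> ^ k) = a k"
proof (rule LIMSEQ_unique)
  show "(\<lambda>N. LINT \<zeta>|circle_measure. (\<Sum>k<N. a k * \<zeta> ^ k) * cnj \<zeta> ^ k)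
      \<longlonglongrightarrow> (LINT \<zeta>|circle_measure. g \<zeta> * cnj \<zeta> ^ k)"
    by (rule circle_partial_sum_tendsto) (intro continuous_intros)
  have "(LINT \<zeta>|circle_measure. (\<Sum>j<N. a j * \<zeta> ^ j) * cnj \<zeta> ^ k) = a k" if "N > k" for N
  proof -
    have "(LINT \<zeta>|circle_measure. (\<Sum>j<N. a j * \<zeta> ^ j) * cnj \<zeta> ^ k) =
        (LINT \<zeta>|circle_measure. (\<Sum>j<N. a j * (\<zeta> ^ j * cnj \<zeta> ^ k)))"
      by (simp add: sum_distrib_right mult.assoc)
    also have "\<dots> = (\<Sum>j<N. a j * (LINT \<zeta>|circle_measure. \<zeta> ^ j * cnj \<zeta> ^ k))"
      by (subst Bochner_Integration.integral_sum)
        (auto intro!: circle_integrable_bounded[where B =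
            1] borel_measurable_continuous_onI continuous_intros
           integrable_mult_right simp: norm_mult norm_power)
    also have "\<dots> = a k"
      using that by (simp add: circle_integral_monomial if_distrib cong: if_cong)
    finally show ?thesis .
  qed
  then show "(\<lambda>N. LINT \<zeta>|circle_measure. (\<Sum>j<N. a j * \<zeta> ^ j) * cnj \<zeta> ^ k) \<longlonglongrightarrow> a k"
    by (intro tendsto_eventually eventually_sequentiallyI[of "Suc k"]) auto
qed

lemma circle_Parseval: "(\<lambda>k. (cmod (a k))\<^sup>2) sums (LINT \<zeta>|circle_measure. (cmod (g \<zeta>))\<^sup>2)"
proof -
  have "(LINT \<zeta>|circle_measure. (cmod (\<Sum>k<N. a k * \<zeta> ^ k))\<^sup>2) = (\<Sum>k<N. (cmod (a k))\<^sup>2)" for N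
  proof -
    have "complex_of_real (LINT \<zeta>|circle_measure. (cmod (\<Sum>k<N. a k * \<zeta> ^ k))\<^sup>2) =
        (LINT \<zeta>|circle_measure. complex_of_real ((cmod (\<Sum>k<N. a k * \<zeta> ^ k))\<^sup>2))"
      by (rule integral_complex_of_real[symmetric])
    also have "\<dots> = (LINT \<zeta>|circle_measure. (\<Sum>k<N. \<Sum>j<N. (a j * cnj (a k)) * (\<zeta> ^ j * cnj \<zeta> ^ k)))"
      by (subst sum.swap) (simp only: complex_norm_square cnj_sum sum_product complex_cnj_mult
          complex_cnj_power mult_ac)
    also have "\<dots> = (\<Sum>k<N. \<Sum>j<N. (a j * cnj (a k)) * (LINT \<zeta>|circle_measure. \<zeta> ^ j * cnj \<zeta> ^ k))"
      by (subst Bochner_Integration.integral_sum Bochner_Integration.integral_mult_right_zero,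
          (auto intro!: circle_integrable_bounded[where B =
              1] borel_measurable_continuous_onI continuous_intros
           Bochner_Integration.integrable_sum integrable_mult_right simp: norm_mult norm_power)[])+
    also have "\<dots> = complex_of_real (\<Sum>k<N. (cmod (a k))\<^sup>2)"
      by (simp add: circle_integral_monomial if_distrib cong: if_cong) (simp only:
          complex_norm_square of_real_power[symmetric])
    finally show ?thesis using of_real_eq_iff by blast
  qed
  moreover have "(\<lambda>N. LINT \<zeta>|circle_measure. (cmod (\<Sum>k<N. a k * \<zeta> ^ k))\<^sup>2)
      \<longlonglongrightarrow> (LINT \<zeta>|circle_measure. (cmod (g \<zeta>))\<^sup>2)"
    by (rule circle_partial_sum_tendsto) (intro continuous_intros)
  ultimately show ?thesis by (simp add: sums_def)
qed

end

text \<open>Absolute convergence at \<open>x\<close> follows from convergence at a point of larger modulus, still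
inside the disc.\<close>
lemma holomorphic_power_series_abs:
  assumes "g holomorphic_on ball 0 R"
  obtains a where "\<And>x. x \<in> ball 0 R \<Longrightarrow> (\<lambda>k. a k * x ^ k) sums g x"
    and "\<And>x. x \<in> ball 0 R \<Longrightarrow> summable (\<lambda>k. cmod (a k * x ^ k))"
proof
  define a where "a k = (deriv ^^ k) g 0 / fact k" for k
  show s: "(\<lambda>k. a k * x ^ k) sums g x" if "x \<in> ball 0 R" for x
    using holomorphic_power_series[OF assms that] by (simp add: a_def)
  show "summable (\<lambda>k. cmod (a k * x ^ k))" if "x \<in> ball 0 R" for x
  proof -
    have "cmod x < R" using that by simp
    from dense[OF this] obtain \<rho> where "cmod x < \<rho>" "\<rho> < R" by blast
    moreover from this have "\<rho> > 0" by (meson norm_ge_zero order_le_less_trans)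
    ultimately show ?thesis
      using s[of "of_real \<rho>"] by (intro powser_insidea[of a "of_real \<rho>"]) (auto simp: sums_iff)
  qed
qed

text \<open>Each coefficient satisfies \<open>|a\<^sub>k| \<rho>\<^sup>k \<le> I\<close>, where \<open>I\<close> is the mean of \<open>|g|\<close> over the circle
of radius \<open>\<rho>\<close>, and \<open>\<Sum> |a\<^sub>k| r\<^sup>k\<close> is then dominated by a geometric series.\<close>
lemma circle_point_evaluation:
  assumes [measurable]: "g \<in> borel_measurable borel" and hol: "g holomorphic_on ball 0 R"
    and w: "cmod w \<le> r" "r < \<rho>" "\<rho> < R"
  shows "ennreal (cmod (g w)) \<le> ennreal (\<rho> / (\<rho> - r)) * (\<integral>\<^sup>+\<zeta>. ennreal (cmod (g (of_real \<rho> * \<zeta>)))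
      \<partial>circle_measure)"
proof -
  have r: "0 \<le> r" "0 < \<rho>" using w norm_ge_zero[of w] by linarith+
  obtain a where a: "\<And>x. x \<in> ball 0 R \<Longrightarrow> (\<lambda>k. a k * x ^ k) sums g x"
    and abs: "\<And>x. x \<in> ball 0 R \<Longrightarrow> summable (\<lambda>k. cmod (a k * x ^ k))"
    using holomorphic_power_series_abs[OF hol] by blast
  let ?h = "\<lambda>\<zeta>. g (of_real \<rho> * \<zeta>)" and ?b = "\<lambda>k. a k * of_real \<rho> ^ k"
  define I where "I = (LINT \<zeta>|circle_measure. cmod (?h \<zeta>))"
  have bdd: "\<exists>B. \<forall>\<zeta>. cmod \<zeta> = 1 \<longrightarrow> cmod (?h \<zeta>) \<le> B"
  proof -
    have "compact (g ` cball 0 \<rho>)"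
      by (rule compact_continuous_image) (use w in \<open>auto
          intro!: holomorphic_on_imp_continuous_on holomorphic_on_subset[OF hol]\<close>)
    then obtain B where "\<And>x. x \<in> g ` cball 0 \<rho> \<Longrightarrow> norm x \<le> B"
      by (meson compact_imp_bounded bounded_iff)
    then show ?thesis using r by (intro exI[of _ B]) (auto simp: norm_mult)
  qed
  then have int: "integrable circle_measure ?h"
    by (auto intro: circle_integrable_bounded)
  have I0: "0 \<le> I" by (simp add: I_def)
  have coeff: "cmod (a k) * \<rho> ^ k \<le> I" for k
  proof -
    have "?b k = (LINT \<zeta>|circle_measure. ?h \<zeta> * cnj \<zeta> ^ k)"
    proof (rule circle_coefficient[symmetric])
      show "(\<lambda>k. ?b k * \<zeta> ^ k) sums ?h \<zeta>" if "cmod \<zeta> = 1" for \<zeta>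
        using a[of "of_real \<rho> * \<zeta>"] that r w by (simp add: norm_mult power_mult_distrib mult_ac)
      show "summable (\<lambda>k. cmod (?b k))"
        using abs[of "of_real \<rho>"] r w by simp
    qed simp
    then have "cmod (a k) * \<rho> ^ k = cmod (LINT \<zeta>|circle_measure. ?h \<zeta> * cnj \<zeta> ^ k)"
      using r by (metis norm_mult norm_power norm_of_real abs_of_pos)
    also have "\<dots> \<le> (LINT \<zeta>|circle_measure. cmod (?h \<zeta> * cnj \<zeta> ^ k))"
      by (rule integral_norm_bound)
    also have "\<dots> = I"
      unfolding I_def
    proof (rule integral_cong_AE)
      show "AE \<zeta> in circle_measure. cmod (?h \<zeta> * cnj \<zeta> ^ k) = cmod (?h \<zeta>)"
        using AE_circle_measure by eventually_elim (simp add: norm_mult norm_power)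
      show "(\<lambda>\<zeta>. cmod (?h \<zeta> * cnj \<zeta> ^ k)) \<in> borel_measurable circle_measure"
        by simp
    qed auto
    finally show ?thesis .
  qed
  have geo: "(\<lambda>k. I * (r / \<rho>) ^ k) sums (I * (1 / (1 - r / \<rho>)))"
    using r w by (intro sums_mult geometric_sums) auto
  have le: "cmod (a k * w ^ k) \<le> I * (r / \<rho>) ^ k" for k
  proof -
    have "cmod (a k * w ^ k) \<le> cmod (a k) * r ^ k"
      using w by (auto simp: norm_mult norm_power intro!: mult_left_mono power_mono)
    also have "\<dots> = (cmod (a k) * \<rho> ^ k) * (r / \<rho>) ^ k"
      using r by (simp add: power_divide)
    also have "\<dots> \<le> I * (r / \<rho>) ^ k"
      using r by (intro mult_right_mono coeff) auto
    finally show ?thesis .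
  qed
  have wR: "w \<in> ball 0 R" using w by simp
  have "cmod (g w) = cmod (\<Sum>k. a k * w ^ k)"
    using a[OF wR] by (simp add: sums_iff)
  also have "\<dots> \<le> (\<Sum>k. cmod (a k * w ^ k))"
    by (rule summable_norm[OF abs[OF wR]])
  also have "\<dots> \<le> (\<Sum>k. I * (r / \<rho>) ^ k)"
    by (rule suminf_le[OF le abs[OF wR]]) (use geo in \<open>simp add: sums_iff\<close>)
  also have "\<dots> = \<rho> / (\<rho> - r) * I"
    using geo r by (simp add: sums_iff field_simps)
  finally have "ennreal (cmod (g w)) \<le> ennreal (\<rho> / (\<rho> - r) * I)" by (rule ennreal_leI)
  also have "\<dots> = ennreal (\<rho> / (\<rho> - r)) * ennreal I"
    using r w by (intro ennreal_mult) (auto simp: I0)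
  also have "ennreal I = (\<integral>\<^sup>+\<zeta>. ennreal (cmod (?h \<zeta>)) \<partial>circle_measure)"
    unfolding I_def using int by (intro nn_integral_eq_integral[symmetric]) auto
  finally show ?thesis .
qed

text \<open>By Parseval's identity this is a comparison of coefficients, where it reads \<open>(1 - s\<^sup>k)\<^sup>2 +
(s\<^sup>k)\<^sup>2 \<le> 1\<close>.\<close>
lemma circle_dilation:
  assumes [measurable]: "g \<in> borel_measurable borel" and hol: "g holomorphic_on ball 0 1"
    and r: "0 \<le> r" "r < 1" and s: "0 \<le> s" "s \<le> 1"
  shows "(\<integral>\<^sup>+\<zeta>. ennreal ((cmod (g (of_real r * \<zeta>) - g (of_real (s * r) * \<zeta>)))\<^sup>2) \<partial>circle_measure)
       + (\<integral>\<^sup>+\<zeta>. ennreal ((cmod (g (of_real (s * r) * \<zeta>)))\<^sup>2) \<partial>circle_measure)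
     \<le> (\<integral>\<^sup>+\<zeta>. ennreal ((cmod (g (of_real r * \<zeta>)))\<^sup>2) \<partial>circle_measure)"
proof -
  obtain a where a: "\<And>x. x \<in> ball 0 1 \<Longrightarrow> (\<lambda>k. a k * x ^ k) sums g x"
    and abs: "\<And>x. x \<in> ball 0 1 \<Longrightarrow> summable (\<lambda>k. cmod (a k * x ^ k))"
    using holomorphic_power_series_abs[OF hol] by blast
  have sr: "0 \<le> s * r" "s * r < 1" using r s by (auto simp: mult_le_one
      intro: le_less_trans[OF mult_left_le_one_le])
  have Pars: "(\<lambda>k. (cmod (c k))\<^sup>2) sums (LINT \<zeta>|circle_measure. (cmod (h \<zeta>))\<^sup>2)"
    "(\<integral>\<^sup>+\<zeta>. ennreal ((cmod (h \<zeta>))\<^sup>2) \<partial>circle_measure) = ennreal (LINT \<zeta>|circle_measure. (cmod (h \<zeta>))\<^sup>2)"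
    if [measurable]: "h \<in> borel_measurable borel"
      and c: "summable (\<lambda>k. cmod (c k))" "\<And>\<zeta>. cmod \<zeta> = 1 \<Longrightarrow> (\<lambda>k. c k * \<zeta> ^ k) sums h \<zeta>" for h c
  proof -
    show "(\<lambda>k. (cmod (c k))\<^sup>2) sums (LINT \<zeta>|circle_measure. (cmod (h \<zeta>))\<^sup>2)"
      using that by (intro circle_Parseval)
    have "cmod (h \<zeta>) \<le> (\<Sum>k. cmod (c k))" if "cmod \<zeta> = 1" for \<zeta>
      using c(2)[OF that] c(1) that summable_norm[of "\<lambda>k. c k * \<zeta> ^ k"]
      by (simp add: sums_iff norm_mult norm_power)
    then have "integrable circle_measure (\<lambda>\<zeta>. (cmod (h \<zeta>))\<^sup>2)"
      by (intro circle_integrable_bounded[where B = "(\<Sum>k. cmod (c k))\<^sup>2"]) (auto simp: power_mono)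
    then show "(\<integral>\<^sup>+\<zeta>. ennreal ((cmod (h \<zeta>))\<^sup>2) \<partial>circle_measure) =
        ennreal (LINT \<zeta>|circle_measure. (cmod (h \<zeta>))\<^sup>2)"
      by (intro nn_integral_eq_integral) auto
  qed
  have ser: "(\<lambda>k. a k * of_real t ^ k * \<zeta> ^ k) sums g (of_real t * \<zeta>)" "summable (\<lambda>k. cmod (a k *
      of_real t ^ k))"
    if "0 \<le> t" "t < 1" "cmod \<zeta> = 1" for t \<zeta>
    using a[of "of_real t * \<zeta>"] abs[of "of_real t"] that
        by (auto simp: norm_mult power_mult_distrib mult_ac)
  let ?r = "\<lambda>k. a k * of_real r ^ k" and ?sr = "\<lambda>k. a k * of_real (s * r) ^ k"
  let ?gr = "\<lambda>\<zeta>. g (of_real r * \<zeta>)" and ?gsr = "\<lambda>\<zeta>. g (of_real (s * r) * \<zeta>)"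
  have abs': "summable (\<lambda>k. cmod (?r k))" "summable (\<lambda>k. cmod (?sr k))"
    using ser(2)[of r 1] ser(2)[of "s * r" 1] r sr by auto
  have abs'': "summable (\<lambda>k. cmod (?r k - ?sr k))"
    by (rule summable_comparison_test'[OF summable_add[OF abs']]) (simp add: norm_triangle_ineq4)
  note P1 = Pars[of "\<lambda>\<zeta>. ?gr \<zeta> - ?gsr \<zeta>", OF _ abs'']
    and P2 = Pars[of ?gsr, OF _ abs'(2)] and P3 = Pars[of ?gr, OF _ abs'(1)]
  have S1: "(\<lambda>k. (?r k - ?sr k) * \<zeta> ^ k) sums (?gr \<zeta> - ?gsr \<zeta>)" if "cmod \<zeta> = 1" for \<zeta>
    unfolding left_diff_distrib using that r sr by (intro sums_diff ser) auto
  have "(LINT \<zeta>|circle_measure. (cmod (?gr \<zeta> - ?gsr \<zeta>))\<^sup>2) + (LINT \<zeta>|circle_measure. (cmod (?gsr \<zeta>))\<^sup>2)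
      \<le> (LINT \<zeta>|circle_measure. (cmod (?gr \<zeta>))\<^sup>2)"
  proof (rule sums_le)
    show "(\<lambda>k. (cmod (?r k - ?sr k))\<^sup>2 + (cmod (?sr k))\<^sup>2) sums
        ((LINT \<zeta>|circle_measure. (cmod (?gr \<zeta> - ?gsr \<zeta>))\<^sup>2) +
            (LINT \<zeta>|circle_measure. (cmod (?gsr \<zeta>))\<^sup>2))"
      using S1 ser(1) sr by (intro sums_add P1 P2) (auto simp del: of_real_mult)
    show "(\<lambda>k. (cmod (?r k))\<^sup>2) sums (LINT \<zeta>|circle_measure. (cmod (?gr \<zeta>))\<^sup>2)"
      using ser(1) r by (intro P3) auto
    show "(cmod (?r k - ?sr k))\<^sup>2 + (cmod (?sr k))\<^sup>2 \<le> (cmod (?r k))\<^sup>2" for k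
    proof -
      have s01: "0 \<le> s ^ k" "s ^ k \<le> 1" using s by (auto simp: power_le_one)
      have "?sr k = of_real (s ^ k) * ?r k" by (simp add: power_mult_distrib)
      then have "(cmod (?sr k))\<^sup>2 = (s ^ k)\<^sup>2 * (cmod (?r k))\<^sup>2"
        by (simp only: norm_mult norm_of_real power_mult_distrib power2_abs)
      moreover have "?r k - ?sr k = of_real (1 - s ^ k) * ?r k"
        by (simp add: power_mult_distrib algebra_simps)
      then have "(cmod (?r k - ?sr k))\<^sup>2 = (1 - s ^ k)\<^sup>2 * (cmod (?r k))\<^sup>2"
        by (simp only: norm_mult norm_of_real power_mult_distrib power2_abs)
      moreover have "(1 - s ^ k)\<^sup>2 + (s ^ k)\<^sup>2 \<le> 1"
        using mult_left_mono[OF s01(2,1)] by (simp add: power2_eq_square algebra_simps)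
      then have "((1 - s ^ k)\<^sup>2 + (s ^ k)\<^sup>2) * (cmod (?r k))\<^sup>2 \<le> 1 * (cmod (?r k))\<^sup>2"
        by (intro mult_right_mono) auto
      ultimately show ?thesis by (simp add: algebra_simps)
    qed
  qed
  moreover have "(\<integral>\<^sup>+\<zeta>. ennreal ((cmod (?gr \<zeta> - ?gsr \<zeta>))\<^sup>2) \<partial>circle_measure) =
      ennreal (LINT \<zeta>|circle_measure. (cmod (?gr \<zeta> - ?gsr \<zeta>))\<^sup>2)"
    using S1 by (intro P1(2)) auto
  moreover have "(\<integral>\<^sup>+\<zeta>. ennreal ((cmod (?gsr \<zeta>))\<^sup>2) \<partial>circle_measure) =
      ennreal (LINT \<zeta>|circle_measure. (cmod (?gsr \<zeta>))\<^sup>2)"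
    using ser(1) sr by (intro P2(2)) (auto simp del: of_real_mult)
  moreover have "(\<integral>\<^sup>+\<zeta>. ennreal ((cmod (?gr \<zeta>))\<^sup>2) \<partial>circle_measure) =
      ennreal (LINT \<zeta>|circle_measure. (cmod (?gr \<zeta>))\<^sup>2)"
    using ser(1) r by (intro P3(2)) auto
  ultimately show ?thesis
    by (simp add: ennreal_plus[symmetric] ennreal_leI del: ennreal_plus)
qed

section \<open>Analytic functions on the polydisc\<close>

lemma open_polydisc: "open (polydisc :: (complex ^ 'n::finite) set)"
proof -
  have eq: "polydisc = (\<Inter>i. {z :: complex ^ 'n. cmod (z $ i) < 1})"
    by (auto simp: polydisc_def)
  show ?thesis
    unfolding eq by (intro open_INT ballI finite open_Collect_less continuous_intros)
qed

definition closed_polydisc :: "real \<Rightarrow> (complex ^ 'n::finite) set" where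
  "closed_polydisc r = {z. \<forall>i. cmod (z $ i) \<le> r}"

lemma closed_polydisc_subset: "r < 1 \<Longrightarrow> closed_polydisc r \<subseteq> polydisc"
  by (auto simp: closed_polydisc_def polydisc_def intro: le_less_trans)

text \<open>Compactness bounds an analytic function on every smaller closed polydisc, which makes all
integrals over tori of radius less than one finite.\<close>
lemma compact_closed_polydisc: "compact (closed_polydisc r :: (complex ^ 'n::finite) set)"
  unfolding compact_eq_bounded_closed
proof
  show "bounded (closed_polydisc r :: (complex ^ 'n) set)"
  proof (rule boundedI)
    fix z :: "complex ^ 'n" assume "z \<in> closed_polydisc r"
    then have "(\<Sum>i\<in>UNIV. cmod (z $ i)) \<le> (\<Sum>i\<in>(UNIV :: 'n set). r)"
      by (intro sum_mono) (auto simp: closed_polydisc_def)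
    moreover have "norm z \<le> (\<Sum>i\<in>UNIV. cmod (z $ i))"
      by (simp add: norm_vec_def L2_set_le_sum)
    ultimately show "norm z \<le> of_nat CARD('n) * r" by simp
  qed
  show "closed (closed_polydisc r :: (complex ^ 'n) set)"
    unfolding closed_polydisc_def by (intro closed_Collect_all closed_Collect_le continuous_intros)
qed

lemma polydisc_in_closed_polydisc:
  assumes "z \<in> polydisc"
  obtains r where "0 \<le> r" "r < 1" "z \<in> closed_polydisc r"
proof
  let ?r = "Max (range (\<lambda>i. cmod (z $ i)))"
  have le: "cmod (z $ i) \<le> ?r" for i by (intro Max_ge) auto
  show "z \<in> closed_polydisc ?r" using le by (simp add: closed_polydisc_def)
  show "0 \<le> ?r" using le[of undefined] norm_ge_zero order_trans by blast
  show "?r < 1" using assms by (subst Max_less_iff) (auto simp: polydisc_def)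
qed

lemma scaleR_torus: "z \<in> torus \<Longrightarrow> 0 \<le> r \<Longrightarrow> r *\<^sub>R z \<in> closed_polydisc r"
  by (simp add: torus_def closed_polydisc_def)

lemma scaleR_polydisc: "z \<in> polydisc \<Longrightarrow> 0 \<le> s \<Longrightarrow> s \<le> 1 \<Longrightarrow> s *\<^sub>R z \<in> polydisc"
  by (auto simp: polydisc_def intro: le_less_trans[OF mult_left_le_one_le])

lemma analytic_imp_continuous_on: "analytic_on_polydisc f \<Longrightarrow> continuous_on polydisc f"
  unfolding analytic_on_polydisc_def
  by (meson continuous_at_imp_continuous_on has_derivative_continuous)

lemma analytic_bounded:
  assumes "analytic_on_polydisc f" "r < 1"
  obtains B where "\<And>z. z \<in> closed_polydisc r \<Longrightarrow> cmod (f z) \<le> B"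
proof -
  have "compact (f ` closed_polydisc r)"
    by (intro compact_continuous_image compact_closed_polydisc
        continuous_on_subset[OF analytic_imp_continuous_on] closed_polydisc_subset assms)
  then obtain B where "\<forall>x\<in>f ` closed_polydisc r. norm x \<le> B"
    using bounded_iff compact_imp_bounded by blast
  then show ?thesis using that by auto
qed

lemma slice_has_field_derivative:
  fixes f :: "complex ^ 'n::finite \<Rightarrow> complex"
  assumes "(f has_derivative f') (at (a + x *s v))" and "\<And>c v. f' (c *s v) = c * f' v"
  shows "((\<lambda>x. f (a + x *s v)) has_field_derivative f' v) (at x)"
proof -
  have "((\<lambda>x. a + x *s v) has_derivative (\<lambda>h. h *s v)) (at x)"
  proof -
    have "bounded_linear (\<lambda>h. h *s v)"
      unfolding vector_scalar_mult_def
      by (intro linear_conv_bounded_linear[THEN iffD1] linearI) (auto simp: vec_eq_iff algebra_simps)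
    from bounded_linear.has_derivative[OF this has_derivative_ident]
    show ?thesis using has_derivative_add[OF has_derivative_const] by fastforce
  qed
  from has_derivative_compose[OF this assms(1)]
  show ?thesis
    unfolding has_field_derivative_def by (simp add: assms(2) mult.commute[of _ "f' v"])
qed

lemma slice_holomorphic:
  assumes "analytic_on_polydisc f" and "\<And>x. x \<in> S \<Longrightarrow> a + x *s v \<in> polydisc"
  shows "(\<lambda>x. f (a + x *s v)) holomorphic_on S"
  unfolding holomorphic_on_def field_differentiable_def
proof (intro ballI)
  fix x assume "x \<in> S"
  then obtain f' where "(f has_derivative f') (at (a + x *s v))" "\<And>c v. f' (c *s v) = c * f' v"
    using assms unfolding analytic_on_polydisc_def by blast
  from slice_has_field_derivative[OF this]
  show "\<exists>f'. ((\<lambda>x. f (a + x *s v)) has_field_derivative f') (at x within S)"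
    using has_field_derivative_at_within by blast
qed

text \<open>Cauchy's inequality for the slice through \<open>x\<close> in direction \<open>h\<close>, on the disc of radius \<open>(\<rho> -
r) / norm h\<close>, which stays in the closed polydisc of radius \<open>\<rho>\<close>.\<close>
lemma derivative_bound:
  fixes f :: "complex ^ 'n::finite \<Rightarrow> complex"
  assumes f: "analytic_on_polydisc f" and x: "x \<in> closed_polydisc r" and r: "r < \<rho>" "\<rho> < 1"
    and B: "\<And>z. z \<in> closed_polydisc \<rho> \<Longrightarrow> cmod (f z) \<le> B"
    and f': "(f has_derivative f') (at x)" "\<And>c v. f' (c *s v) = c * f' v"
  shows "cmod (f' h) \<le> B / (\<rho> - r) * norm h"
proof (cases "h = 0")
  case True
  then show ?thesis using f'(2)[of 0 h] by simp
next
  case False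
  define \<delta> where "\<delta> = (\<rho> - r) / norm h"
  have \<delta>: "\<delta> > 0" using r False by (simp add: \<delta>_def)
  have mem: "x + c *s h \<in> closed_polydisc \<rho>" if "cmod c \<le> \<delta>" for c
    unfolding closed_polydisc_def
  proof (clarsimp)
    fix i
    have "cmod (x $ i + c * h $ i) \<le> cmod (x $ i) + cmod c * cmod (h $ i)"
      by (metis norm_triangle_ineq norm_mult)
    also have "\<dots> \<le> r + \<delta> * norm h"
      using x that \<delta> by (intro add_mono mult_mono Finite_Cartesian_Product.norm_nth_le)
        (auto simp: closed_polydisc_def)
    also have "\<dots> = \<rho>" using False by (simp add: \<delta>_def)
    finally show "cmod (x $ i + c * h $ i) \<le> \<rho>" .
  qed
  let ?u = "\<lambda>c. f (x + c *s h)"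
  have hol: "?u holomorphic_on cball 0 \<delta>"
    using mem closed_polydisc_subset[OF r(2)] by (intro slice_holomorphic f) auto
  have "cmod ((deriv ^^ 1) ?u 0) \<le> fact 1 * B / \<delta> ^ 1"
  proof (rule Cauchy_inequality)
    show "?u holomorphic_on ball 0 \<delta>" using hol by (rule holomorphic_on_subset) auto
    show "continuous_on (cball 0 \<delta>) ?u" by (rule holomorphic_on_imp_continuous_on[OF hol])
  qed (use \<delta> mem B in auto)
  moreover have "(?u has_field_derivative f' h) (at 0)"
    by (rule slice_has_field_derivative) (use f' in auto)
  then have "deriv ?u 0 = f' h" by (rule DERIV_imp_deriv)
  ultimately show ?thesis by (simp add: \<delta>_def)
qed

text \<open>Being zero outside the polydisc makes these functions Borel measurable on the whole space.\<close>
definition polydisc_functions :: "(complex ^ 'n::finite \<Rightarrow> complex) set" where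
  "polydisc_functions = {f. analytic_on_polydisc f \<and> (\<forall>z. z \<notin> polydisc \<longrightarrow> f z = 0)}"

lemma analytic_add: "analytic_on_polydisc f \<Longrightarrow> analytic_on_polydisc g \<Longrightarrow>
    analytic_on_polydisc (\<lambda>z. f z + g z)"
  unfolding analytic_on_polydisc_def
  by (intro ballI, elim ballE[where x = z for z] exE conjE, intro exI conjI,
      rule has_derivative_add) (auto simp: algebra_simps)

lemma analytic_mult:
  assumes "analytic_on_polydisc f" "analytic_on_polydisc g"
  shows "analytic_on_polydisc (\<lambda>z. f z * g z)"
  unfolding analytic_on_polydisc_def
proof
  fix z :: "complex ^ 'a" assume z: "z \<in> polydisc"
  obtain f' g' where d: "(f has_derivative f') (at z)" "\<And>c v. f' (c *s v) = c * f' v"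
    "(g has_derivative g') (at z)" "\<And>c v. g' (c *s v) = c * g' v"
    using assms z unfolding analytic_on_polydisc_def by metis
  show "\<exists>h. ((\<lambda>z. f z * g z) has_derivative h) (at z) \<and> (\<forall>c v. h (c *s v) = c * h v)"
    by (intro exI conjI, rule has_derivative_mult[OF d(1,3)]) (simp add: d algebra_simps)
qed

lemma analytic_const: "analytic_on_polydisc (\<lambda>z. c)"
  unfolding analytic_on_polydisc_def by (auto intro!: exI[of _ "\<lambda>_. 0"])

lemma analytic_cong:
  assumes "analytic_on_polydisc f" "\<And>z. z \<in> polydisc \<Longrightarrow> g z = f z"
  shows "analytic_on_polydisc g"
  unfolding analytic_on_polydisc_def
proof
  fix z :: "complex ^ 'a" assume z: "z \<in> polydisc"
  obtain f' where d: "(f has_derivative f') (at z)" and l: "\<And>c v. f' (c *s v) = c * f' v"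
    using assms(1) z unfolding analytic_on_polydisc_def by metis
  have "(g has_derivative f') (at z)"
    by (rule has_derivative_transform_within_open[OF d open_polydisc z]) (simp add: assms(2))
  then show "\<exists>f'. (g has_derivative f') (at z) \<and> (\<forall>c v. f' (c *s v) = c * f' v)"
    using l by blast
qed

text \<open>Outside the polydisc \<open>s z\<close> may well lie in the polydisc, hence the explicit value 0 there.\<close>
definition dilation :: "real \<Rightarrow> (complex ^ 'n::finite \<Rightarrow> complex) \<Rightarrow> complex ^ 'n \<Rightarrow> complex" where
  "dilation s f z = (if z \<in> polydisc then f (s *\<^sub>R z) else 0)"

lemma scaleR_vector_scalar_mult: "s *\<^sub>R (c *s v) = c *s (s *\<^sub>R (v :: complex ^ 'n))"
  by (simp add: vec_eq_iff)

lemma analytic_dilation: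
  assumes f: "analytic_on_polydisc f" and s: "0 \<le> s" "s \<le> 1"
  shows "analytic_on_polydisc (dilation s f)"
proof (rule analytic_cong)
  show "analytic_on_polydisc (\<lambda>z. f (s *\<^sub>R z))"
    unfolding analytic_on_polydisc_def
  proof
    fix z :: "complex ^ 'a" assume z: "z \<in> polydisc"
    obtain f' where f': "(f has_derivative f') (at (s *\<^sub>R z))" "\<And>c v. f' (c *s v) = c * f' v"
      using f scaleR_polydisc[OF z s] unfolding analytic_on_polydisc_def by metis
    have "((\<lambda>z. f (s *\<^sub>R z)) has_derivative (\<lambda>h. f' (s *\<^sub>R h))) (at z)"
      by (rule has_derivative_compose[where f = "\<lambda>z. s *\<^sub>R z"]) (use f' in \<open>auto
          intro!: derivative_eq_intros\<close>)
    then show "\<exists>f'. ((\<lambda>z. f (s *\<^sub>R z)) has_derivative f') (at z) \<and> (\<forall>c v. f' (c *s v) = c * f' v)"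
      using f'(2) by (intro exI conjI) (auto simp: scaleR_vector_scalar_mult)
  qed
qed (simp add: dilation_def)

lemma polydisc_functionsD:
  assumes "f \<in> polydisc_functions"
  shows "analytic_on_polydisc f" "z \<notin> polydisc \<Longrightarrow> f z = 0"
  using assms by (auto simp: polydisc_functions_def)

lemma polydisc_functions_add:
  "f \<in> polydisc_functions \<Longrightarrow> g \<in> polydisc_functions \<Longrightarrow> (\<lambda>z. f z + g z) \<in> polydisc_functions"
  by (auto simp: polydisc_functions_def intro: analytic_add)

lemma polydisc_functions_mult:
  "analytic_on_polydisc \<phi> \<Longrightarrow> f \<in> polydisc_functions \<Longrightarrow> (\<lambda>z. \<phi> z * f z) \<in> polydisc_functions"
  by (auto simp: polydisc_functions_def intro: analytic_mult)

lemma polydisc_functions_cmult: "f \<in> polydisc_functions \<Longrightarrow> (\<lambda>z. c * f z) \<in> polydisc_functions"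
  by (intro polydisc_functions_mult analytic_const)

lemma polydisc_functions_diff:
  assumes "f \<in> polydisc_functions" "g \<in> polydisc_functions"
  shows "(\<lambda>z. f z - g z) \<in> polydisc_functions"
  using polydisc_functions_add[OF assms(1) polydisc_functions_cmult[OF assms(2), of "-1"]] by simp

lemma polydisc_functions_dilation:
  "f \<in> polydisc_functions \<Longrightarrow> 0 \<le> s \<Longrightarrow> s \<le> 1 \<Longrightarrow> dilation s f \<in> polydisc_functions"
  using analytic_dilation by (auto simp: polydisc_functions_def dilation_def)

lemma polydisc_functions_measurable:
  assumes "f \<in> polydisc_functions"
  shows "f \<in> borel_measurable borel"
proof -
  have "(\<lambda>z. indicator polydisc z *\<^sub>R f z) \<in> borel_measurable borel"
    using assms by (intro borel_measurable_continuous_on_indicator analytic_imp_continuous_on)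
      (auto simp: open_polydisc polydisc_functions_def)
  also have "(\<lambda>z. indicator polydisc z *\<^sub>R f z) = f"
    using assms by (auto simp: polydisc_functions_def fun_eq_iff indicator_def)
  finally show ?thesis .
qed

lemma measurable_scaleR_vec [measurable]: "(\<lambda>z :: complex ^ 'n::finite. r *\<^sub>R z) \<in> borel_measurable
    borel"
  by (intro borel_measurable_continuous_onI continuous_intros)

section \<open>Means over tori of increasing radius\<close>

lemma radial_integrable:
  assumes f: "f \<in> polydisc_functions" and r: "0 \<le> r" "r < 1"
  shows "integrable torus_measure (\<lambda>z. (cmod (f (r *\<^sub>R z)))\<^sup>2)"
proof -
  note [measurable] = polydisc_functions_measurable[OF f]
  obtain B where B: "\<And>z. z \<in> closed_polydisc r \<Longrightarrow> cmod (f z) \<le> B"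
    using analytic_bounded[OF polydisc_functionsD(1)[OF f] r(2)] by blast
  show ?thesis
  proof (rule torus.integrable_const_bound)
    show "AE z in torus_measure. norm ((cmod (f (r *\<^sub>R z)))\<^sup>2) \<le> B\<^sup>2"
      using AE_torus_measure by eventually_elim (use r in \<open>auto intro!: B scaleR_torus power_mono\<close>)
  qed simp
qed

lemma nn_integral_radial:
  assumes f: "f \<in> polydisc_functions" and r: "0 \<le> r" "r < 1"
  shows "(\<integral>\<^sup>+z. ennreal ((cmod (f (r *\<^sub>R z)))\<^sup>2) \<partial>torus_measure) = ennreal (radial_mean f r)"
  unfolding radial_mean_def by (intro nn_integral_eq_integral radial_integrable assms) auto

lemma radial_mean_nonneg: "0 \<le> radial_mean f r"
  by (simp add: radial_mean_def)

lemma rot_UNIV: "rot UNIV \<zeta> z = \<zeta> *s z"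
  by (simp add: rot_def vec_eq_iff)

lemma measurable_vector_scalar_mult:
  "(\<lambda>x. a + x *s v) \<in> borel_measurable (borel :: complex measure)" for v :: "complex ^ 'n::finite"
  unfolding vector_scalar_mult_def by (intro borel_measurable_continuous_onI continuous_intros)

text \<open>For \<open>z\<close> on the torus the one-variable inequality holds for the slice \<open>x \<mapsto> f (x z)\<close>.
Averaging it over all \<open>z\<close> gives the claim, because a mean over the torus does not change when the
function is first averaged over the simultaneous rotations of all coordinates.\<close>
lemma radial_mean_dilation:
  fixes f :: "complex ^ 'n::finite \<Rightarrow> complex"
  assumes f: "f \<in> polydisc_functions" and r: "0 \<le> r" "r < 1" and s: "0 \<le> s" "s \<le> 1"
  shows "radial_mean (\<lambda>z. f z - dilation s f z) r + radial_mean f (s * r) \<le> radial_mean f r"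
proof -
  note [measurable] = polydisc_functions_measurable[OF f]
  have d: "(\<lambda>z. f z - dilation s f z) \<in> polydisc_functions"
    by (intro polydisc_functions_diff polydisc_functions_dilation f s)
  note [measurable] = polydisc_functions_measurable[OF d]
  have sr: "0 \<le> s * r" "s * r < 1" using r s by (auto intro: le_less_trans[OF mult_left_le_one_le])
  have avg: "ennreal (radial_mean h t) =
      (\<integral>\<^sup>+z. (\<integral>\<^sup>+\<zeta>. ennreal ((cmod (h (t *\<^sub>R (\<zeta> *s z))))\<^sup>2) \<partial>circle_measure) \<partial>torus_measure)"
    if "h \<in> polydisc_functions" "0 \<le> t" "t < 1" for h :: "complex ^ 'n \<Rightarrow> complex" and t
  proof -
    note [measurable] = polydisc_functions_measurable[OF that(1)]
    show ?thesis
      unfolding nn_integral_radial[OF that, symmetric]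
      by (subst nn_integral_torus_rot[where S = UNIV]) (simp_all add: rot_UNIV)
  qed
  have m: "(\<lambda>z. \<integral>\<^sup>+\<zeta>. ennreal ((cmod (h (t *\<^sub>R (\<zeta> *s z))))\<^sup>2) \<partial>circle_measure) \<in> borel_measurable borel"
    if "h \<in> polydisc_functions" for h :: "complex ^ 'n \<Rightarrow> complex" and t
  proof -
    note [measurable] = polydisc_functions_measurable[OF that(1)]
    have "(\<lambda>p. t *\<^sub>R (snd p *s fst p)) \<in> borel_measurable ((borel :: (complex ^ 'n) measure) \<Otimes>\<^sub>M
        (borel :: complex measure))"
      unfolding borel_prod vector_scalar_mult_def
          by (intro borel_measurable_continuous_onI continuous_intros)
    then have "(\<lambda>p. t *\<^sub>R (snd p *s fst p)) \<in> borel_measurable ((borel :: (complex ^ 'n) measure)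
        \<Otimes>\<^sub>M circle_measure)"
      by (simp cong: measurable_cong_sets)
    from measurable_compose[OF this polydisc_functions_measurable[OF that(1)]]
    show ?thesis
      by (intro circle.borel_measurable_nn_integral) (simp add: case_prod_unfold)
  qed
  have "ennreal (radial_mean (\<lambda>z. f z - dilation s f z) r) + ennreal (radial_mean f (s * r)) =
    (\<integral>\<^sup>+z. (\<integral>\<^sup>+\<zeta>. ennreal ((cmod (f (r *\<^sub>R (\<zeta> *s z)) - dilation s f (r *\<^sub>R (\<zeta> *s z))))\<^sup>2)
        \<partial>circle_measure) +
          (\<integral>\<^sup>+\<zeta>. ennreal ((cmod (f ((s * r) *\<^sub>R (\<zeta> *s z))))\<^sup>2) \<partial>circle_measure) \<partial>torus_measure)"
    unfolding avg[OF d r] avg[OF f sr]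
    by (rule nn_integral_add[symmetric]) (use m[OF d] m[OF f] in auto)
  also have "\<dots> \<le> (\<integral>\<^sup>+z. (\<integral>\<^sup>+\<zeta>. ennreal ((cmod (f (r *\<^sub>R (\<zeta> *s z))))\<^sup>2) \<partial>circle_measure) \<partial>torus_measure)"
  proof (rule nn_integral_mono_AE, use AE_torus_measure in eventually_elim)
    fix z :: "complex ^ 'n" assume z: "z \<in> torus"
    define g where "g x = f (0 + x *s z)" for x
    have g: "g \<in> borel_measurable borel"
      unfolding g_def using measurable_compose[OF measurable_vector_scalar_mult
          polydisc_functions_measurable[OF f]] .
    have hol: "g holomorphic_on ball 0 1"
      unfolding g_def using z
      by (intro slice_holomorphic polydisc_functionsD[OF f]) (auto simp: polydisc_def torus_def
          norm_mult)
    have gt: "f (t *\<^sub>R (\<zeta> *s z)) = g (of_real t * \<zeta>)" for t \<zeta>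
      unfolding g_def
      by (rule arg_cong[where f = f]) (simp add: vec_eq_iff scaleR_conv_of_real[where 'a = complex])
    have "(\<integral>\<^sup>+\<zeta>. ennreal ((cmod (f (r *\<^sub>R (\<zeta> *s z)) - dilation s f (r *\<^sub>R (\<zeta> *s z))))\<^sup>2)
        \<partial>circle_measure) =
        (\<integral>\<^sup>+\<zeta>. ennreal ((cmod (g (of_real r * \<zeta>) - g (of_real (s * r) * \<zeta>)))\<^sup>2) \<partial>circle_measure)"
    proof (rule nn_integral_cong_AE, use AE_circle_measure in eventually_elim)
      fix \<zeta> :: complex assume "cmod \<zeta> = 1"
      then have "r *\<^sub>R (\<zeta> *s z) \<in> polydisc"
        using z r by (auto simp: polydisc_def torus_def norm_mult)
      then show "ennreal ((cmod (f (r *\<^sub>R (\<zeta> *s z)) - dilation s f (r *\<^sub>R (\<zeta> *s z))))\<^sup>2) =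
        ennreal ((cmod (g (of_real r * \<zeta>) - g (of_real (s * r) * \<zeta>)))\<^sup>2)"
        by (simp add: dilation_def gt[of "s * r", symmetric] gt[of r, symmetric] del: of_real_mult)
    qed
    then show "(\<integral>\<^sup>+\<zeta>. ennreal ((cmod (f (r *\<^sub>R (\<zeta> *s z)) - dilation s f (r *\<^sub>R (\<zeta> *s z))))\<^sup>2)
        \<partial>circle_measure) +
          (\<integral>\<^sup>+\<zeta>. ennreal ((cmod (f ((s * r) *\<^sub>R (\<zeta> *s z))))\<^sup>2) \<partial>circle_measure)
        \<le> (\<integral>\<^sup>+\<zeta>. ennreal ((cmod (f (r *\<^sub>R (\<zeta> *s z))))\<^sup>2) \<partial>circle_measure)"
      using circle_dilation[OF g hol r s] by (simp add: gt del: of_real_mult)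
  qed
  also have "\<dots> = ennreal (radial_mean f r)"
    by (rule avg[OF f r, symmetric])
  finally show ?thesis
    by (simp add: radial_mean_nonneg ennreal_plus[symmetric] del: ennreal_plus)
qed

text \<open>The special case \<open>s = r / r'\<close> of the dilation inequality, with the first mean dropped.\<close>
lemma radial_mean_mono:
  assumes f: "f \<in> polydisc_functions" and "0 \<le> r" "r \<le> r'" "r' < 1"
  shows "radial_mean f r \<le> radial_mean f r'"
proof (cases "r' = 0")
  case False
  then show ?thesis
    using radial_mean_dilation[OF f, of r' "r / r'"] radial_mean_nonneg assms
    by (smt (verit) divide_le_eq_1 nonzero_eq_divide_eq zero_le_divide_iff)
qed (use assms in auto)

section \<open>Bounded point evaluations\<close>

text \<open>The coordinates are moved one at a time from the point \<open>w\<close> to the torus of radius \<open>\<rho>\<close>, each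
step costing the constant of the one-variable estimate. The point \<open>z\<close> of the torus only fixes the
phase at which the slice in the coordinate \<open>j\<close> is parametrized, and rotation invariance absorbs
that phase.\<close>
lemma point_evaluation_partial:
  fixes h :: "complex ^ 'n::finite \<Rightarrow> complex" and S :: "'n set"
  assumes h: "h \<in> polydisc_functions" and w: "w \<in> closed_polydisc r" and r: "0 \<le> r" "r < \<rho>" "\<rho> < 1"
  shows "ennreal (cmod (h w)) \<le> ennreal ((\<rho> / (\<rho> - r)) ^ card S) *
    (\<integral>\<^sup>+z. ennreal (cmod (h (\<chi> i. if i \<in> S then of_real \<rho> * z $ i else w $ i))) \<partial>torus_measure)"
  using finite[of S]
proof (induction S rule: finite_induct)
  case empty
  then show ?case by (simp add: torus.emeasure_space_1[simplified])
next
  case (insert j S)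
  note [measurable] = polydisc_functions_measurable[OF h]
  let ?mix = "\<lambda>S z. \<chi> i. if i \<in> S then of_real \<rho> * z $ i else w $ i"
  let ?C = "\<rho> / (\<rho> - r)"
  have C: "?C \<ge> 0" using r by simp
  have mix [measurable]: "?mix S \<in> borel_measurable borel" for S
    by (intro borel_measurable_continuous_onI continuous_on_vec_lambda, rename_tac i, case_tac "i \<in> S")
       (auto intro!: continuous_intros)
  have "(\<integral>\<^sup>+z. ennreal (cmod (h (?mix S z))) \<partial>torus_measure) \<le>
      (\<integral>\<^sup>+z. ennreal ?C * (\<integral>\<^sup>+\<zeta>. ennreal (cmod (h (?mix (insert j S) (rot {j} \<zeta> z))))
          \<partial>circle_measure) \<partial>torus_measure)"
  proof (rule nn_integral_mono_AE, use AE_torus_measure in eventually_elim)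
    fix z :: "complex ^ 'n" assume z: "z \<in> torus"
    \<comment> \<open>The slice in coordinate \<open>j\<close> attains the value \<open>w $ j\<close> there at the parameter \<open>w $ j * cnj (z $ j)\<close>.\<close>
    define a where "a = (\<chi> i. if i = j then 0 else ?mix S z $ i)"
    define v where "v = axis j (z $ j)"
    define g where "g x = h (a + x *s v)" for x
    have g: "g \<in> borel_measurable borel"
      unfolding g_def using measurable_compose[OF measurable_vector_scalar_mult
          polydisc_functions_measurable[OF h]] .
    have zw: "cmod (z $ i) = 1" "cmod (w $ i) \<le> r" for i
      using z w by (auto simp: torus_def closed_polydisc_def)
    have r1: "cmod (w $ i) < 1" for i using zw(2)[of i] r by linarith
    have hol: "g holomorphic_on ball 0 1"
      unfolding g_def using r r1
      by (intro slice_holomorphic polydisc_functionsD[OF h]) (auto simp: polydisc_def norm_mult zw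
          a_def v_def axis_def)
    have zz: "cnj (z $ j) * z $ j = 1"
      using complex_norm_square[of "z $ j"] zw(1)[of j] by (simp add: mult.commute)
    have "h (?mix S z) = g (w $ j * cnj (z $ j))"
      unfolding g_def using zz insert.hyps
      by (intro arg_cong[where f = h]) (auto simp: vec_eq_iff a_def v_def axis_def mult.assoc)
    moreover have "h (?mix (insert j S) (rot {j} \<zeta> z)) = g (of_real \<rho> * \<zeta>)" for \<zeta>
      unfolding g_def
      by (intro arg_cong[where f = h]) (auto simp: vec_eq_iff a_def v_def axis_def rot_def)
    moreover have "ennreal (cmod (g (w $ j * cnj (z $ j)))) \<le>
        ennreal ?C * (\<integral>\<^sup>+\<zeta>. ennreal (cmod (g (of_real \<rho> * \<zeta>))) \<partial>circle_measure)"
      by (rule circle_point_evaluation[OF g hol]) (use r zw in \<open>auto simp: norm_mult\<close>)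
    ultimately show "ennreal (cmod (h (?mix S z))) \<le>
        ennreal ?C * (\<integral>\<^sup>+\<zeta>. ennreal (cmod (h (?mix (insert j S) (rot {j} \<zeta> z)))) \<partial>circle_measure)"
      by simp
  qed
  also have "\<dots> = ennreal ?C * (\<integral>\<^sup>+z. (\<integral>\<^sup>+\<zeta>. ennreal (cmod (h (?mix (insert j S) (rot {j} \<zeta> z))))
      \<partial>circle_measure) \<partial>torus_measure)"
  proof (rule nn_integral_cmult)
    have "(\<lambda>p. rot {j} (snd p) (fst p)) \<in> borel_measurable ((borel :: (complex ^ 'n) measure) \<Otimes>\<^sub>M
        (borel :: complex measure))"
      unfolding borel_prod by (intro borel_measurable_continuous_onI continuous_intros)
    then have "(\<lambda>p. rot {j} (snd p) (fst p)) \<in> borel_measurable ((borel :: (complex ^ 'n) measure)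
        \<Otimes>\<^sub>M circle_measure)"
      by (simp cong: measurable_cong_sets)
    note rot = this
    define H where "H p = h (?mix (insert j S) (rot {j} (snd p) (fst p)))" for p
    have [measurable]: "H \<in> borel_measurable (borel \<Otimes>\<^sub>M circle_measure)"
      unfolding H_def
      by (rule measurable_compose[OF measurable_compose[OF rot mix] polydisc_functions_measurable[OF
          h]])
    have "(\<lambda>(z, \<zeta>). ennreal (cmod (H (z, \<zeta>)))) \<in> borel_measurable (borel \<Otimes>\<^sub>M circle_measure)"
      by measurable
    from circle.borel_measurable_nn_integral[OF this, unfolded H_def prod.case fst_conv snd_conv]
    show "(\<lambda>z. \<integral>\<^sup>+\<zeta>. ennreal (cmod (h (?mix (insert j S) (rot {j} \<zeta> z)))) \<partial>circle_measure) \<in>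
        borel_measurable torus_measure"
      by simp
  qed
  also have "(\<integral>\<^sup>+z. (\<integral>\<^sup>+\<zeta>. ennreal (cmod (h (?mix (insert j S) (rot {j} \<zeta> z)))) \<partial>circle_measure)
      \<partial>torus_measure)
      = (\<integral>\<^sup>+z. ennreal (cmod (h (?mix (insert j S) z))) \<partial>torus_measure)"
    by (rule nn_integral_torus_rot[symmetric]) measurable
  finally have "ennreal (?C ^ card S) * (\<integral>\<^sup>+z. ennreal (cmod (h (?mix S z))) \<partial>torus_measure) \<le>
      ennreal (?C ^ card S) * (ennreal ?C * (\<integral>\<^sup>+z. ennreal (cmod (h (?mix (insert j S) z)))
          \<partial>torus_measure))"
    by (rule mult_left_mono) simp
  moreover have "ennreal (?C ^ card (insert j S)) = ennreal (?C ^ card S) * ennreal ?C"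
    unfolding card_insert_disjoint[OF insert.hyps] power_Suc2 using C by (intro ennreal_mult) auto
  ultimately show ?case
    using order_trans[OF insert.IH] by (simp only: mult.assoc)
qed

text \<open>Applied to the analytic function \<open>f\<^sup>2\<close>, the estimate by a mean of moduli becomes one by a
mean of squares.\<close>
lemma point_evaluation:
  fixes f :: "complex ^ 'n::finite \<Rightarrow> complex"
  assumes f: "f \<in> polydisc_functions" and w: "w \<in> closed_polydisc r" and r: "0 \<le> r" "r < \<rho>" "\<rho> < 1"
  shows "(cmod (f w))\<^sup>2 \<le> (\<rho> / (\<rho> - r)) ^ CARD('n) * radial_mean f \<rho>"
proof -
  have h: "(\<lambda>z. f z * f z) \<in> polydisc_functions"
    by (intro polydisc_functions_mult polydisc_functionsD f)
  have "(\<chi> i. of_real \<rho> * z $ i) = \<rho> *\<^sub>R z" for z :: "complex ^ 'n"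
    by (simp add: vec_eq_iff scaleR_conv_of_real[where 'a = complex])
  then have "ennreal ((cmod (f w))\<^sup>2) \<le> ennreal ((\<rho> / (\<rho> - r)) ^ CARD('n)) * ennreal (radial_mean f \<rho>)"
    using point_evaluation_partial[OF h w r, of UNIV] nn_integral_radial[OF f, of \<rho>] r
    by (simp add: norm_mult power2_eq_square)
  also have "\<dots> = ennreal ((\<rho> / (\<rho> - r)) ^ CARD('n) * radial_mean f \<rho>)"
    using r by (intro ennreal_mult[symmetric] radial_mean_nonneg) auto
  finally show ?thesis
    using r by (subst (asm) ennreal_le_iff) (auto intro!: mult_nonneg_nonneg radial_mean_nonneg)
qed

section \<open>The inner product of the Hardy space\<close>

lemma Hardy2_iff:
  "f \<in> Hardy2 \<longleftrightarrow> f \<in> polydisc_functions \<and> bdd_above (radial_mean f ` {0..<1})"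
  by (auto simp: Hardy2_def polydisc_functions_def)

lemma Hardy2_polydisc_functions: "f \<in> Hardy2 \<Longrightarrow> f \<in> polydisc_functions"
  by (simp add: Hardy2_iff)

lemma hnorm_sq:
  assumes "f \<in> Hardy2"
  shows "(hnorm f)\<^sup>2 = (SUP r\<in>{0..<1}. radial_mean f r)"
proof -
  have "0 \<le> (SUP r\<in>{0..<1}. radial_mean f r)"
    using assms by (intro cSUP_upper2[where x = 0]) (auto simp: radial_mean_nonneg Hardy2_iff)
  then show ?thesis by (simp add: hnorm_def)
qed

lemma hnorm_nonneg: "f \<in> Hardy2 \<Longrightarrow> 0 \<le> hnorm f"
  unfolding hnorm_def
  by (intro real_sqrt_ge_zero cSUP_upper2[where x = 0]) (auto simp: radial_mean_nonneg Hardy2_iff)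

lemma radial_mean_le_hnorm: "f \<in> Hardy2 \<Longrightarrow> 0 \<le> r \<Longrightarrow> r < 1 \<Longrightarrow> radial_mean f r \<le> (hnorm f)\<^sup>2"
  unfolding hnorm_sq by (intro cSUP_upper) (auto simp: Hardy2_iff)

lemma Hardy2I:
  assumes "f \<in> polydisc_functions" and "\<And>r. 0 \<le> r \<Longrightarrow> r < 1 \<Longrightarrow> radial_mean f r \<le> B"
  shows "f \<in> Hardy2" "(hnorm f)\<^sup>2 \<le> B"
proof -
  show *: "f \<in> Hardy2"
    using assms by (auto simp: Hardy2_iff intro!: bdd_aboveI2)
  show "(hnorm f)\<^sup>2 \<le> B"
    unfolding hnorm_sq[OF *] by (intro cSUP_least) (use assms in auto)
qed

lemma eventually_radius: "\<forall>\<^sub>F r in at_left 1. 0 \<le> r \<and> r < (1::real)"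
  using eventually_at_left_real[of 0 "1::real"] by (auto elim: eventually_mono)

text \<open>A bounded increasing function converges to its supremum. Unlike the supremum, the limit is
compatible with sums of functions, which is what the parallelogram law needs.\<close>
lemma radial_mean_tendsto_hnorm:
  assumes f: "f \<in> Hardy2"
  shows "(radial_mean f \<longlongrightarrow> (hnorm f)\<^sup>2) (at_left 1)"
proof (rule order_tendstoI)
  fix a assume "a < (hnorm f)\<^sup>2"
  then obtain r where r: "0 \<le> r" "r < 1" "a < radial_mean f r"
    unfolding hnorm_sq[OF f] using f by (subst (asm) less_cSUP_iff) (auto simp: Hardy2_iff)
  show "\<forall>\<^sub>F x in at_left 1. a < radial_mean f x"
    using eventually_at_left_real[OF r(2)]
  proof eventually_elim
    case (elim x)
    have "radial_mean f r \<le> radial_mean f x"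
      by (rule radial_mean_mono[OF Hardy2_polydisc_functions[OF f]]) (use r elim in auto)
    with r(3) show ?case by simp
  qed
next
  fix a assume "(hnorm f)\<^sup>2 < a"
  then show "\<forall>\<^sub>F x in at_left 1. radial_mean f x < a"
    using eventually_radius by (auto elim!: eventually_mono
        intro: le_less_trans[OF radial_mean_le_hnorm] f)
qed

lemma Hardy2_add:
  assumes "f \<in> Hardy2" "g \<in> Hardy2"
  shows "(\<lambda>z. f z + g z) \<in> Hardy2"
proof (rule Hardy2I)
  note fg = assms[THEN Hardy2_polydisc_functions]
  note s = polydisc_functions_add[OF fg]
  show "(\<lambda>z. f z + g z) \<in> polydisc_functions" by (fact s)
  fix r :: real assume r: "0 \<le> r" "r < 1"
  have "radial_mean (\<lambda>z. f z + g z) r \<le>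
      (LINT z|torus_measure. 2 * (cmod (f (r *\<^sub>R z)))\<^sup>2 + 2 * (cmod (g (r *\<^sub>R z)))\<^sup>2)"
    unfolding radial_mean_def
  proof (rule integral_mono)
    fix z
    have "(cmod (f (r *\<^sub>R z) + g (r *\<^sub>R z)))\<^sup>2 \<le> (cmod (f (r *\<^sub>R z)) + cmod (g (r *\<^sub>R z)))\<^sup>2"
      by (intro power_mono norm_triangle_ineq) auto
    also have "\<dots> \<le> 2 * (cmod (f (r *\<^sub>R z)))\<^sup>2 + 2 * (cmod (g (r *\<^sub>R z)))\<^sup>2"
      using sum_squares_bound[of "cmod (f (r *\<^sub>R z))" "cmod (g (r *\<^sub>R z))"] by (simp add: power2_sum)
    finally show "(cmod (f (r *\<^sub>R z) + g (r *\<^sub>R z)))\<^sup>2 \<le> \<dots>" .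
  qed (intro radial_integrable[OF s] radial_integrable fg r Bochner_Integration.integrable_add
      integrable_mult_right)+
  also have "\<dots> = 2 * radial_mean f r + 2 * radial_mean g r"
    unfolding radial_mean_def
    by (simp add: Bochner_Integration.integral_add integrable_mult_right radial_integrable fg r)
  also have "\<dots> \<le> 2 * (hnorm f)\<^sup>2 + 2 * (hnorm g)\<^sup>2"
    using radial_mean_le_hnorm assms r by (intro add_mono mult_left_mono) auto
  finally show "radial_mean (\<lambda>z. f z + g z) r \<le> \<dots>" .
qed

lemma Hardy2_bounded_mult:
  assumes f: "f \<in> Hardy2" and \<phi>: "analytic_on_polydisc \<phi>" and B: "\<And>z. z \<in> polydisc \<Longrightarrow> cmod (\<phi> z) \<le> B"
  shows "(\<lambda>z. \<phi> z * f z) \<in> Hardy2" "hnorm (\<lambda>z. \<phi> z * f z) \<le> B * hnorm f"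
proof -
  note p = polydisc_functions_mult[OF \<phi> Hardy2_polydisc_functions[OF f]]
  have B0: "0 \<le> B" by (rule order_trans[OF norm_ge_zero B[of 0]]) (simp add: polydisc_def)
  have le: "radial_mean (\<lambda>z. \<phi> z * f z) r \<le> (B * hnorm f)\<^sup>2" if r: "0 \<le> r" "r < 1" for r
  proof -
    have "radial_mean (\<lambda>z. \<phi> z * f z) r \<le> (LINT z|torus_measure. B\<^sup>2 * (cmod (f (r *\<^sub>R z)))\<^sup>2)"
      unfolding radial_mean_def
    proof (rule integral_mono)
      fix z :: "complex ^ 'a"
      show "(cmod (\<phi> (r *\<^sub>R z) * f (r *\<^sub>R z)))\<^sup>2 \<le> B\<^sup>2 * (cmod (f (r *\<^sub>R z)))\<^sup>2"
        using B[of "r *\<^sub>R z"] polydisc_functionsD(2)[OF Hardy2_polydisc_functions[OF f], of "r *\<^sub>R z"]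
        by (cases "r *\<^sub>R z \<in> polydisc") (auto simp: norm_mult power_mult_distrib
            intro!: mult_right_mono power_mono)
    qed (intro radial_integrable[OF p] radial_integrable Hardy2_polydisc_functions f r
        integrable_mult_right)+
    also have "\<dots> = B\<^sup>2 * radial_mean f r" by (simp add: radial_mean_def)
    also have "\<dots> \<le> B\<^sup>2 * (hnorm f)\<^sup>2" by (intro mult_left_mono radial_mean_le_hnorm f r) auto
    finally show ?thesis by (simp add: power_mult_distrib)
  qed
  show "(\<lambda>z. \<phi> z * f z) \<in> Hardy2" by (rule Hardy2I[OF p le])
  have "(hnorm (\<lambda>z. \<phi> z * f z))\<^sup>2 \<le> (B * hnorm f)\<^sup>2" by (rule Hardy2I[OF p le])
  then show "hnorm (\<lambda>z. \<phi> z * f z) \<le> B * hnorm f"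
    by (rule power2_le_imp_le) (simp add: B0 hnorm_nonneg f)
qed

lemma Hardy2_cmult: "f \<in> Hardy2 \<Longrightarrow> (\<lambda>z. c * f z) \<in> Hardy2"
  by (rule Hardy2_bounded_mult(1)[where B = "cmod c"]) (auto intro: analytic_const)

lemma Hardy2_diff:
  assumes "f \<in> Hardy2" "g \<in> Hardy2" shows "(\<lambda>z. f z - g z) \<in> Hardy2"
  using Hardy2_add[OF assms(1) Hardy2_cmult[OF assms(2), of "-1"]] by simp

lemma Hardy2_zero: "(\<lambda>z. 0) \<in> Hardy2"
  by (rule Hardy2I(1)[where B = 0]) (auto simp: polydisc_functions_def analytic_const radial_mean_def)

text \<open>Approximations of the inner product: an integral for each radius, hence bilinear without any
limit.\<close>
definition radial_inner :: "(complex ^ 'n::finite \<Rightarrow> complex) \<Rightarrow> (complex ^ 'n \<Rightarrow> complex) \<Rightarrow> real \<Rightarrow>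
    real" where
  "radial_inner f g r = (LINT z|torus_measure. f (r *\<^sub>R z) \<bullet> g (r *\<^sub>R z))"

text \<open>The real part of the inner product, by the real polarization formula.\<close>
definition real_hinner :: "(complex ^ 'n::finite \<Rightarrow> complex) \<Rightarrow> (complex ^ 'n \<Rightarrow> complex) \<Rightarrow> real" where
  "real_hinner f g = ((hnorm (\<lambda>z. f z + g z))\<^sup>2 - (hnorm (\<lambda>z. f z - g z))\<^sup>2) / 4"

lemma hinner_eq: "hinner f g = Complex (real_hinner f g) (real_hinner f (\<lambda>z. \<i> * g z))"
proof -
  have k: "{..<4::nat} = {0, 1, 2, 3}" by auto
  show ?thesis
    unfolding hinner_def real_hinner_def k
    by (simp add: complex_eq_iff power3_eq_cube power2_eq_square[of \<i>])
qed

lemma radial_inner_integrable: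
  assumes f: "f \<in> polydisc_functions" and g: "g \<in> polydisc_functions" and r: "0 \<le> r" "r < 1"
  shows "integrable torus_measure (\<lambda>z. f (r *\<^sub>R z) \<bullet> g (r *\<^sub>R z))"
proof (rule Bochner_Integration.integrable_bound)
  note [measurable] = polydisc_functions_measurable[OF f] polydisc_functions_measurable[OF g]
  show "integrable torus_measure (\<lambda>z. (cmod (f (r *\<^sub>R z)))\<^sup>2 + (cmod (g (r *\<^sub>R z)))\<^sup>2)"
    by (intro Bochner_Integration.integrable_add radial_integrable f g r)
  show "(\<lambda>z. f (r *\<^sub>R z) \<bullet> g (r *\<^sub>R z)) \<in> borel_measurable torus_measure" by simp
  show "AE z in torus_measure. norm (f (r *\<^sub>R z) \<bullet> g (r *\<^sub>R z)) \<le> norm ((cmod (f (r *\<^sub>R z)))\<^sup>2 +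
      (cmod (g (r *\<^sub>R z)))\<^sup>2)"
  proof (rule AE_I2)
    fix z
    have "\<bar>f (r *\<^sub>R z) \<bullet> g (r *\<^sub>R z)\<bar> \<le> cmod (f (r *\<^sub>R z)) * cmod (g (r *\<^sub>R z))"
      by (rule Cauchy_Schwarz_ineq2)
    also have "\<dots> \<le> (cmod (f (r *\<^sub>R z)))\<^sup>2 + (cmod (g (r *\<^sub>R z)))\<^sup>2"
      using sum_squares_bound[of "cmod (f (r *\<^sub>R z))" "cmod (g (r *\<^sub>R z))"]
        mult_nonneg_nonneg[OF norm_ge_zero[of "f (r *\<^sub>R z)"] norm_ge_zero[of "g (r *\<^sub>R z)"]] by linarith
    finally show "norm (f (r *\<^sub>R z) \<bullet> g (r *\<^sub>R z)) \<le> norm ((cmod (f (r *\<^sub>R z)))\<^sup>2 +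
        (cmod (g (r *\<^sub>R z)))\<^sup>2)"
      by simp
  qed
qed

lemma radial_inner_add:
  assumes "f \<in> polydisc_functions" "g \<in> polydisc_functions" "h \<in> polydisc_functions" "0 \<le> r" "r < 1"
  shows "radial_inner (\<lambda>z. f z + g z) h r = radial_inner f h r + radial_inner g h r"
  unfolding radial_inner_def inner_add_left
  by (intro Bochner_Integration.integral_add radial_inner_integrable assms)

lemma radial_inner_cmult: "radial_inner (\<lambda>z. of_real c * f z) h r = c * radial_inner f h r"
  unfolding radial_inner_def scaleR_conv_of_real[symmetric] inner_scaleR_left by simp

text \<open>Polarization turns the convergence of the radial means into that of the radial inner
products.\<close>
lemma radial_inner_tendsto:
  assumes f: "f \<in> Hardy2" and g: "g \<in> Hardy2"
  shows "(radial_inner f g \<longlongrightarrow> real_hinner f g) (at_left 1)"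
proof -
  note fg = f[THEN Hardy2_polydisc_functions] g[THEN Hardy2_polydisc_functions]
  have eq: "(radial_mean (\<lambda>z. f z + g z) r - radial_mean (\<lambda>z. f z - g z) r) / 4 = radial_inner f g r"
    if "0 \<le> r \<and> r < 1" for r
  proof -
    have r: "0 \<le> r" "r < 1" using that by auto
    have "radial_mean (\<lambda>z. f z + g z) r - radial_mean (\<lambda>z. f z - g z) r =
        (LINT z|torus_measure. (cmod (f (r *\<^sub>R z) +
            g (r *\<^sub>R z)))\<^sup>2 - (cmod (f (r *\<^sub>R z) - g (r *\<^sub>R z)))\<^sup>2)"
      unfolding radial_mean_def
      by (intro Bochner_Integration.integral_diff[symmetric]
           radial_integrable[OF polydisc_functions_add[OF fg] r] radial_integrable[OF
               polydisc_functions_diff[OF fg] r])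
    also have "\<dots> = (LINT z|torus_measure. 4 * (f (r *\<^sub>R z) \<bullet> g (r *\<^sub>R z)))"
      by (intro Bochner_Integration.integral_cong refl)
        (simp add: power2_norm_eq_inner algebra_simps inner_commute)
    finally show ?thesis by (simp add: radial_inner_def)
  qed
  have "((\<lambda>r. (radial_mean (\<lambda>z. f z + g z) r - radial_mean (\<lambda>z. f z - g z) r) / 4) \<longlongrightarrow> real_hinner f
      g) (at_left 1)"
    unfolding real_hinner_def
    by (intro tendsto_intros radial_mean_tendsto_hnorm Hardy2_add Hardy2_diff f g) auto
  then show ?thesis
    by (rule Lim_transform_eventually) (use eventually_radius in \<open>eventually_elim, simp add: eq\<close>)
qed

text \<open>Identities for the inner product are inherited from the radial ones in the limit.\<close>
lemma real_hinner_eqI: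
  assumes "f \<in> Hardy2" "g \<in> Hardy2" "(L \<longlongrightarrow> c) (at_left 1)"
    and "\<And>r. 0 \<le> r \<Longrightarrow> r < 1 \<Longrightarrow> radial_inner f g r = L r"
  shows "real_hinner f g = c"
proof (rule tendsto_unique[OF _ radial_inner_tendsto[OF assms(1,2)]])
  show "(radial_inner f g \<longlongrightarrow> c) (at_left 1)"
    by (rule Lim_transform_eventually[OF assms(3)]) (use eventually_radius
        in \<open>eventually_elim, simp add: assms(4)\<close>)
qed simp

lemma real_hinner_commute: "real_hinner f g = real_hinner g f" if "f \<in> Hardy2" "g \<in> Hardy2"
  by (rule real_hinner_eqI[OF that radial_inner_tendsto]) (auto simp: that radial_inner_def
      inner_commute)

lemma real_hinner_add:
  assumes "f \<in> Hardy2" "g \<in> Hardy2" "h \<in> Hardy2"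
  shows "real_hinner (\<lambda>z. f z + g z) h = real_hinner f h + real_hinner g h"
  by (rule real_hinner_eqI[OF Hardy2_add _ tendsto_add[OF radial_inner_tendsto radial_inner_tendsto]])
     (auto simp: assms radial_inner_add Hardy2_polydisc_functions)

lemma real_hinner_cmult:
  assumes "f \<in> Hardy2" "h \<in> Hardy2"
  shows "real_hinner (\<lambda>z. of_real c * f z) h = c * real_hinner f h"
  by (rule real_hinner_eqI[OF Hardy2_cmult _ tendsto_mult[OF tendsto_const radial_inner_tendsto]])
     (auto simp: assms radial_inner_cmult)

lemma real_hinner_self: "real_hinner f f = (hnorm f)\<^sup>2" if "f \<in> Hardy2"
  by (rule real_hinner_eqI[OF that that radial_mean_tendsto_hnorm[OF that]])
     (simp add: radial_inner_def radial_mean_def power2_norm_eq_inner)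

section \<open>Completeness of the Hardy space\<close>

lemma Hardy2_point_evaluation:
  fixes f :: "complex ^ 'n::finite \<Rightarrow> complex"
  assumes f: "f \<in> Hardy2" and r: "0 \<le> r" "r < \<rho>" "\<rho> < 1" and w: "w \<in> closed_polydisc r"
  shows "cmod (f w) \<le> sqrt ((\<rho> / (\<rho> - r)) ^ CARD('n)) * hnorm f"
proof (rule power2_le_imp_le)
  have "(cmod (f w))\<^sup>2 \<le> (\<rho> / (\<rho> - r)) ^ CARD('n) * radial_mean f \<rho>"
    by (rule point_evaluation[OF Hardy2_polydisc_functions[OF f] w r])
  also have "\<dots> \<le> (\<rho> / (\<rho> - r)) ^ CARD('n) * (hnorm f)\<^sup>2"
    using r by (intro mult_left_mono radial_mean_le_hnorm f) auto
  also have "\<dots> = (sqrt ((\<rho> / (\<rho> - r)) ^ CARD('n)) * hnorm f)\<^sup>2"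
    using r by (simp add: power_mult_distrib)
  finally show "(cmod (f w))\<^sup>2 \<le> \<dots>" .
qed (use r in \<open>simp add: hnorm_nonneg f\<close>)

lemma hnorm_eq_0_imp:
  assumes f: "f \<in> Hardy2" and "hnorm f = 0"
  shows "f = (\<lambda>z. 0)"
proof
  fix z
  show "f z = 0"
  proof (cases "z \<in> polydisc")
    case True
    then obtain r where r: "0 \<le> r" "r < 1" "z \<in> closed_polydisc r"
      by (rule polydisc_in_closed_polydisc)
    then show ?thesis
      using Hardy2_point_evaluation[OF f r(1) _ _ r(3), of "(1 + r) / 2"] assms(2) by simp
  next
    case False
    then show ?thesis using polydisc_functionsD(2)[OF Hardy2_polydisc_functions[OF f]] by blast
  qed
qed

text \<open>By \<open>derivative_bound\<close> the derivatives are uniformly Cauchy on a small ball as well, so the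
limit is differentiable there, and complex linearity of the derivative survives the pointwise
limit.\<close>
lemma analytic_locally_uniform_limit:
  fixes f :: "nat \<Rightarrow> complex ^ 'n::finite \<Rightarrow> complex"
  assumes f: "\<And>n. analytic_on_polydisc (f n)"
    and lim: "\<And>z. z \<in> polydisc \<Longrightarrow> (\<lambda>n. f n z) \<longlonglongrightarrow> g z"
    and Cau: "\<And>r. 0 \<le> r \<Longrightarrow> r < 1 \<Longrightarrow> uniformly_Cauchy_on (closed_polydisc r) f"
  shows "analytic_on_polydisc g"
  unfolding analytic_on_polydisc_def
proof
  fix z :: "complex ^ 'n" assume "z \<in> polydisc"
  then obtain q where q: "0 \<le> q" "q < 1" "z \<in> closed_polydisc q"
    by (rule polydisc_in_closed_polydisc)
  define \<delta> where "\<delta> = (1 - q) / 3"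
  define r where "r = q + \<delta>"
  define \<rho> where "\<rho> = r + \<delta>"
  have r: "0 \<le> r" "r < \<rho>" "\<rho> < 1" "0 < \<delta>" "r < 1"
  proof -
    have "0 < \<delta>" "3 * \<delta> = 1 - q" using q by (simp_all add: \<delta>_def)
    then show "0 \<le> r" "r < \<rho>" "\<rho> < 1" "0 < \<delta>" "r < 1" using q unfolding \<rho>_def r_def by linarith+
  qed
  define S where "S = ball z \<delta>"
  have S: "x \<in> closed_polydisc r" if "x \<in> S" for x
    unfolding closed_polydisc_def
  proof clarsimp
    fix i
    have "cmod (x $ i - z $ i) \<le> norm (x - z)"
      by (metis Finite_Cartesian_Product.norm_nth_le vector_minus_component)
    then have "cmod (x $ i - z $ i) \<le> \<delta>"
      using that by (simp add: S_def dist_norm norm_minus_commute)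
    moreover have "cmod (z $ i) \<le> q" using q by (simp add: closed_polydisc_def)
    ultimately show "cmod (x $ i) \<le> r"
      using norm_triangle_sub[of "x $ i" "z $ i"] by (simp add: r_def)
  qed
  then have SP: "x \<in> polydisc" if "x \<in> S" for x
    using closed_polydisc_subset[OF r(5)] that by blast
  have "\<forall>n x. \<exists>f'. x \<in> polydisc \<longrightarrow> (f n has_derivative f') (at x) \<and> (\<forall>c v. f' (c *s v) = c * f' v)"
    using f unfolding analytic_on_polydisc_def by blast
  then obtain D where D: "\<And>n x. x \<in> polydisc \<Longrightarrow> (f n has_derivative D n x) (at x)"
    "\<And>n x c v. x \<in> polydisc \<Longrightarrow> D n x (c *s v) = c * D n x v"
    by metis
  \<comment> \<open>The derivatives are uniformly Cauchy on \<open>S\<close> in operator norm.\<close>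
  have DC: "\<exists>N. \<forall>m\<ge>N. \<forall>n\<ge>N. \<forall>x\<in>S. \<forall>h. cmod (D m x h - D n x h) \<le> e * norm h" if e: "e > 0" for e
  proof -
    have "0 < e * (\<rho> - r)" using e r by simp
    then obtain N where N: "\<And>m n x. m \<ge> N \<Longrightarrow> n \<ge> N \<Longrightarrow> x \<in> closed_polydisc \<rho> \<Longrightarrow>
        dist (f m x) (f n x) < e * (\<rho> - r)"
      using Cau[of \<rho>] r unfolding uniformly_Cauchy_on_def by fastforce
    have "cmod (D m x h - D n x h) \<le> e * norm h" if mn: "m \<ge> N" "n \<ge> N" and x: "x \<in> S" for m n x h
    proof -
      have "analytic_on_polydisc (\<lambda>z. f m z + (-1) * f n z)"
        by (intro analytic_add analytic_mult analytic_const f)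
      then have a: "analytic_on_polydisc (\<lambda>z. f m z - f n z)" by simp
      have "cmod (D m x h - D n x h) \<le> (e * (\<rho> - r)) / (\<rho> - r) * norm h"
      proof (rule derivative_bound[OF a S[OF x] r(2,3)])
        show "cmod (f m w - f n w) \<le> e * (\<rho> - r)" if "w \<in> closed_polydisc \<rho>" for w
          using N[OF mn that] by (simp add: dist_norm)
        show "((\<lambda>z. f m z - f n z) has_derivative (\<lambda>h. D m x h - D n x h)) (at x)"
          by (intro has_derivative_diff D SP x)
      qed (simp add: D(2)[OF SP[OF x]] algebra_simps)
      then show ?thesis using r by simp
    qed
    then show ?thesis by blast
  qed
  define g' where "g' x h = lim (\<lambda>n. D n x h)" for x h
  have g': "(\<lambda>n. D n x h) \<longlonglongrightarrow> g' x h" if x: "x \<in> S" for x h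
    unfolding g'_def
  proof (rule convergent_LIMSEQ_iff[THEN iffD1], rule Cauchy_convergent, rule metric_CauchyI)
    fix e :: real assume "e > 0"
    then have "e / (norm h + 1) > 0" by (simp add: add_nonneg_pos)
    then obtain N where N: "\<forall>m\<ge>N. \<forall>n\<ge>N. \<forall>x\<in>S. \<forall>h'. cmod (D m x h' - D n x h') \<le> e / (norm h +
        1) * norm h'"
      using DC by blast
    have "e / (norm h + 1) * norm h < e"
      using \<open>e > 0\<close> by (simp add: pos_divide_less_eq add_nonneg_pos)
    moreover have "dist (D m x h) (D n x h) \<le> e / (norm h + 1) * norm h" if "m \<ge> N" "n \<ge> N" for m n
      using N that x unfolding dist_norm by blast
    ultimately have "\<forall>m\<ge>N. \<forall>n\<ge>N. dist (D m x h) (D n x h) < e"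
      by (meson le_less_trans)
    then show "\<exists>M. \<forall>m\<ge>M. \<forall>n\<ge>M. dist (D m x h) (D n x h) < e" ..
  qed
  have nle: "\<forall>\<^sub>F n in sequentially. \<forall>x\<in>S. \<forall>h. cmod (D n x h - g' x h) \<le> e * norm h" if e: "e > 0" for e
  proof -
    obtain N where N: "\<forall>m\<ge>N. \<forall>n\<ge>N. \<forall>x\<in>S. \<forall>h. cmod (D m x h - D n x h) \<le> e * norm h"
      using DC[OF e] by blast
    have "cmod (D n x h - g' x h) \<le> e * norm h" if "n \<ge> N" "x \<in> S" for n x h
    proof (rule tendsto_upperbound)
      show "(\<lambda>m. cmod (D n x h - D m x h)) \<longlonglongrightarrow> cmod (D n x h - g' x h)"
        by (intro tendsto_intros g' that)
      show "\<forall>\<^sub>F m in sequentially. cmod (D n x h - D m x h) \<le> e * norm h"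
        using eventually_ge_at_top[of N] by eventually_elim (use N that in auto)
    qed simp
    then show ?thesis by (auto simp: eventually_sequentially)
  qed
  have zS: "z \<in> S" using r by (simp add: S_def)
  have "\<exists>G. \<forall>x\<in>S. (\<lambda>n. f n x) \<longlonglongrightarrow> G x \<and> (G has_derivative g' x) (at x within S)"
  proof (rule has_derivative_sequence[where f = f and f' = D and g' = g' and S = S
      and l = "g z", OF _ _ nle zS lim[OF SP[OF zS]]])
    show "convex S" by (simp add: S_def)
    show "(f n has_derivative D n x) (at x within S)" if "x \<in> S" for n x
      by (rule has_derivative_at_withinI[OF D(1)[OF SP[OF that]]])
  qed
  then obtain G where G: "\<And>x. x \<in> S \<Longrightarrow> (\<lambda>n. f n x) \<longlonglongrightarrow> G x" "\<And>x. x \<in> S \<Longrightarrow>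
      (G has_derivative g' x) (at x within S)"
    by blast
  have "(G has_derivative g' z) (at z)"
    using G(2)[OF zS] at_within_open[OF zS] by (simp add: S_def)
  then have "(g has_derivative g' z) (at z)"
  proof (rule has_derivative_transform_within_open[of _ _ _ _ S])
    show "open S" by (simp add: S_def)
    show "G x = g x" if "x \<in> S" for x
      using LIMSEQ_unique[OF G(1)[OF that] lim[OF SP[OF that]]] .
  qed (rule zS)
  moreover have "g' z (c *s v) = c * g' z v" for c v
  proof (rule LIMSEQ_unique[OF g'[OF zS]])
    show "(\<lambda>n. D n z (c *s v)) \<longlonglongrightarrow> c * g' z v"
      unfolding D(2)[OF SP[OF zS]] by (intro tendsto_intros g' zS)
  qed
  ultimately show "\<exists>f'. (g has_derivative f') (at z) \<and> (\<forall>c v. f' (c *s v) = c * f' v)" by blast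
qed

text \<open>Bounded point evaluations produce an analytic pointwise limit \<open>g\<close>. Fatou's lemma bounds the
radial means of \<open>f\<^sub>n - g\<close> by those of \<open>f\<^sub>n - f\<^sub>m\<close> for large \<open>m\<close>, hence uniformly in the radius.\<close>
lemma Hardy2_complete:
  fixes f :: "nat \<Rightarrow> complex ^ 'n::finite \<Rightarrow> complex"
  assumes f: "\<And>n. f n \<in> Hardy2"
    and Cau: "\<And>e. e > 0 \<Longrightarrow> \<exists>N. \<forall>m\<ge>N. \<forall>n\<ge>N. hnorm (\<lambda>z. f m z - f n z) < e"
  obtains g where "g \<in> Hardy2" "(\<lambda>n. hnorm (\<lambda>z. f n z - g z)) \<longlonglongrightarrow> 0"
proof -
  note fp = f[THEN Hardy2_polydisc_functions]
  have uC: "uniformly_Cauchy_on (closed_polydisc r) f" if r: "0 \<le> r" "r < 1" for r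
    unfolding uniformly_Cauchy_on_def
  proof (intro allI impI)
    fix e :: real assume e: "e > 0"
    define \<rho> where "\<rho> = (1 + r) / 2"
    have \<rho>: "r < \<rho>" "\<rho> < 1" using r by (auto simp: \<rho>_def)
    define K where "K = sqrt ((\<rho> / (\<rho> - r)) ^ CARD('n))"
    have K: "K > 0" using r \<rho> by (simp add: K_def)
    then obtain N where N: "\<forall>m\<ge>N. \<forall>n\<ge>N. hnorm (\<lambda>z. f m z - f n z) < e / K"
      using Cau[of "e / K"] e by auto
    have "dist (f m x) (f n x) < e" if "x \<in> closed_polydisc r" "m \<ge> N" "n \<ge> N" for x m n
    proof -
      have "cmod (f m x - f n x) \<le> K * hnorm (\<lambda>z. f m z - f n z)"
        unfolding K_def by (rule Hardy2_point_evaluation[OF Hardy2_diff[OF f f] r(1) \<rho> that(1)])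
      also have "\<dots> < K * (e / K)" using N that K by (intro mult_strict_left_mono) auto
      finally show ?thesis using K by (simp add: dist_norm)
    qed
    then show "\<exists>M. \<forall>x\<in>closed_polydisc r. \<forall>m\<ge>M. \<forall>n\<ge>M. dist (f m x) (f n x) < e" by blast
  qed
  define g where "g z = lim (\<lambda>n. f n z)" for z
  have lim: "(\<lambda>n. f n z) \<longlonglongrightarrow> g z" for z
  proof (cases "z \<in> polydisc")
    case True
    then obtain r where "0 \<le> r" "r < 1" "z \<in> closed_polydisc r"
      by (rule polydisc_in_closed_polydisc)
    with uC[of r] have "Cauchy (\<lambda>n. f n z)"
      by (force simp: uniformly_Cauchy_on_def Cauchy_def)
    then show ?thesis
      unfolding g_def by (intro convergent_LIMSEQ_iff[THEN iffD1] Cauchy_convergent)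
  next
    case False
    then have "(\<lambda>n. f n z) = (\<lambda>n. 0)" using polydisc_functionsD(2)[OF fp] by auto
    then show ?thesis by (simp add: g_def)
  qed
  have g: "g \<in> polydisc_functions"
    unfolding polydisc_functions_def
  proof (intro CollectI conjI allI impI)
    show "analytic_on_polydisc g"
      by (rule analytic_locally_uniform_limit[OF polydisc_functionsD(1)[OF fp] lim uC])
    show "g z = 0" if "z \<notin> polydisc" for z
      using that polydisc_functionsD(2)[OF fp] by (simp add: g_def)
  qed
  \<comment> \<open>Squares, since Fatou's lemma bounds radial means.\<close>
  have est: "\<exists>N. \<forall>n\<ge>N. (\<lambda>z. f n z - g z) \<in> Hardy2 \<and> (hnorm (\<lambda>z. f n z - g z))\<^sup>2 \<le> e\<^sup>2" if e: "e > 0"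
      for e
  proof -
    obtain N where N: "\<forall>m\<ge>N. \<forall>n\<ge>N. hnorm (\<lambda>z. f m z - f n z) < e"
      using Cau[OF e] by (elim exE)
    have "radial_mean (\<lambda>z. f n z - g z) r \<le> e\<^sup>2" if n: "n \<ge> N" and r: "0 \<le> r" "r < 1" for n r
    proof -
      note m = polydisc_functions_measurable[OF polydisc_functions_diff[OF fp fp]]
      have "ennreal (radial_mean (\<lambda>z. f n z - g z) r) =
          (\<integral>\<^sup>+z. liminf (\<lambda>m. ennreal ((cmod (f n (r *\<^sub>R z) - f m (r *\<^sub>R z)))\<^sup>2)) \<partial>torus_measure)"
        unfolding nn_integral_radial[OF polydisc_functions_diff[OF fp g] r, symmetric]
        by (intro nn_integral_cong lim_imp_Liminf[symmetric] tendsto_ennrealI tendsto_intros lim) simp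
      also have "\<dots> \<le> liminf (\<lambda>m. \<integral>\<^sup>+z. ennreal ((cmod (f n (r *\<^sub>R z) - f m (r *\<^sub>R z)))\<^sup>2)
          \<partial>torus_measure)"
        by (rule nn_integral_liminf)
          (use measurable_compose[OF measurable_scaleR_vec m] in simp)
      also have "\<dots> = liminf (\<lambda>m. ennreal (radial_mean (\<lambda>z. f n z - f m z) r))"
        by (simp only: nn_integral_radial[OF polydisc_functions_diff[OF fp fp] r])
      also have "\<dots> \<le> ennreal (e\<^sup>2)"
      proof (rule Liminf_le)
        have "radial_mean (\<lambda>z. f n z - f m z) r \<le> e\<^sup>2" if "m \<ge> N" for m
        proof -
          have "radial_mean (\<lambda>z. f n z - f m z) r \<le> (hnorm (\<lambda>z. f n z - f m z))\<^sup>2"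
            by (rule radial_mean_le_hnorm[OF Hardy2_diff[OF f f] r])
          also have "\<dots> \<le> e\<^sup>2"
            using N n that by (intro power_mono hnorm_nonneg Hardy2_diff f) (auto intro: less_imp_le)
          finally show ?thesis .
        qed
        then show "\<forall>\<^sub>F m in sequentially. ennreal (radial_mean (\<lambda>z. f n z - f m z) r) \<le> ennreal (e\<^sup>2)"
          by (auto simp: eventually_sequentially intro!: ennreal_leI)
      qed simp
      finally show ?thesis by simp
    qed
    from Hardy2I[OF polydisc_functions_diff[OF fp g] this]
    show ?thesis by (intro exI[of _ N] allI impI conjI)
  qed
  from est[OF zero_less_one] obtain N where
    "\<forall>n\<ge>N. (\<lambda>z. f n z - g z) \<in> Hardy2 \<and> (hnorm (\<lambda>z. f n z - g z))\<^sup>2 \<le> 1\<^sup>2"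
    by (elim exE)
  then have N: "(\<lambda>z. f N z - g z) \<in> Hardy2" by simp
  have "g \<in> Hardy2" using Hardy2_diff[OF f[of N] N] by simp
  moreover have "(\<lambda>n. hnorm (\<lambda>z. f n z - g z)) \<longlonglongrightarrow> 0"
  proof (rule LIMSEQ_I)
    fix e :: real assume "e > 0"
    then have "e / 2 > 0" and half_bound: "e / 2 < e" by simp_all
    from est[OF this(1)] obtain N where
      N: "\<forall>n\<ge>N. (\<lambda>z. f n z - g z) \<in> Hardy2 \<and> (hnorm (\<lambda>z. f n z - g z))\<^sup>2 \<le> (e / 2)\<^sup>2"
      by (elim exE)
    have "norm (hnorm (\<lambda>z. f n z - g z) - 0) < e" if "n \<ge> N" for n
    proof -
      have "hnorm (\<lambda>z. f n z - g z) \<le> e / 2"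
        using N that \<open>e > 0\<close> by (intro power2_le_imp_le[of "hnorm (\<lambda>z. f n z - g z)"]) auto
      moreover have "0 \<le> hnorm (\<lambda>z. f n z - g z)" using N that by (intro hnorm_nonneg) auto
      ultimately show ?thesis using half_bound by simp
    qed
    then show "\<exists>N. \<forall>n\<ge>N. norm (hnorm (\<lambda>z. f n z - g z) - 0) < e"
      by blast
  qed
  ultimately show ?thesis by (rule that)
qed

text \<open>As a type, the Hardy space can be an instance of the real inner product spaces. Real scalars
suffice: all subspaces that occur are invariant under multiplication by \<open>\<i>\<close>, and for these,
orthogonality with respect to the complex inner product and to its real part is the same.\<close>
typedef ('n::finite) hardy = "Hardy2 :: (complex ^ 'n \<Rightarrow> complex) set"
  morphisms hardy_fun Abs_hardy
  using Hardy2_zero by blast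

setup_lifting type_definition_hardy

lemma hardy_fun_Hardy2 [simp]: "hardy_fun f \<in> Hardy2"
  by (rule hardy_fun)

instantiation hardy :: (finite) real_vector
begin
lift_definition zero_hardy :: "'a hardy" is "\<lambda>z. 0" by (rule Hardy2_zero)
lift_definition plus_hardy :: "'a hardy \<Rightarrow> 'a hardy \<Rightarrow> 'a hardy" is "\<lambda>f g z. f z + g z"
  by (rule Hardy2_add)
lift_definition minus_hardy :: "'a hardy \<Rightarrow> 'a hardy \<Rightarrow> 'a hardy" is "\<lambda>f g z. f z - g z"
  by (rule Hardy2_diff)
lift_definition uminus_hardy :: "'a hardy \<Rightarrow> 'a hardy" is "\<lambda>f z. - f z"
  using Hardy2_cmult[of _ "-1"] by simp
lift_definition scaleR_hardy :: "real \<Rightarrow> 'a hardy \<Rightarrow> 'a hardy" is "\<lambda>c f z. of_real c * f z"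
  by (rule Hardy2_cmult)
instance
  by standard (transfer, simp add: algebra_simps fun_eq_iff)+
end

instantiation hardy :: (finite) real_inner
begin
lift_definition norm_hardy :: "'a hardy \<Rightarrow> real" is hnorm .
lift_definition inner_hardy :: "'a hardy \<Rightarrow> 'a hardy \<Rightarrow> real" is real_hinner .
definition dist_hardy :: "'a hardy \<Rightarrow> 'a hardy \<Rightarrow> real" where "dist_hardy f g = norm (f - g)"
definition sgn_hardy :: "'a hardy \<Rightarrow> 'a hardy" where "sgn_hardy f = f /\<^sub>R norm f"
definition uniformity_hardy :: "('a hardy \<times> 'a hardy) filter"
  where "uniformity_hardy = (INF e\<in>{0 <..}. principal {(x, y). dist x y < e})"
definition open_hardy :: "'a hardy set \<Rightarrow> bool"
  where "open_hardy S = (\<forall>x\<in>S. \<forall>\<^sub>F (x', y) in uniformity. x' = x \<longrightarrow> y \<in> S)"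
instance
proof
  fix f g h :: "'a hardy" and c :: real
  show "dist f g = norm (f - g)" by (rule dist_hardy_def)
  show "sgn f = f /\<^sub>R norm f" by (rule sgn_hardy_def)
  show "uniformity = (INF e\<in>{0 <..}. principal {(x, y :: 'a hardy). dist x y < e})"
    by (rule uniformity_hardy_def)
  show "open S = (\<forall>x\<in>S. \<forall>\<^sub>F (x', y) in uniformity. x' = x \<longrightarrow> y \<in> S)" for S :: "'a hardy set"
    by (rule open_hardy_def)
  show "f \<bullet> g = g \<bullet> f" by transfer (rule real_hinner_commute)
  show "(f + g) \<bullet> h = f \<bullet> h + g \<bullet> h" by transfer (rule real_hinner_add)
  show "(c *\<^sub>R f) \<bullet> g = c * (f \<bullet> g)" by transfer (rule real_hinner_cmult)
  show "0 \<le> f \<bullet> f" by transfer (simp add: real_hinner_self)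
  show "f \<bullet> f = 0 \<longleftrightarrow> f = 0"
  proof
    show "f = 0" if "f \<bullet> f = 0"
      using that by transfer (simp add: real_hinner_self hnorm_eq_0_imp)
    show "f \<bullet> f = 0" if "f = 0"
      unfolding that by transfer (simp add: real_hinner_def)
  qed
  show "norm f = sqrt (f \<bullet> f)" by transfer (simp add: real_hinner_self hnorm_nonneg)
qed
end

instance hardy :: (finite) complete_space
proof
  fix X :: "nat \<Rightarrow> 'a hardy" assume X: "Cauchy X"
  have "\<exists>N. \<forall>m\<ge>N. \<forall>n\<ge>N. hnorm (\<lambda>z. hardy_fun (X m) z - hardy_fun (X n) z) < e" if "e > 0" for e
    using metric_CauchyD[OF X that] by (simp add: dist_norm norm_hardy.rep_eq minus_hardy.rep_eq)
  then obtain g where g: "g \<in> Hardy2" "(\<lambda>n. hnorm (\<lambda>z. hardy_fun (X n) z - g z)) \<longlonglongrightarrow> 0"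
    using Hardy2_complete[of "\<lambda>n. hardy_fun (X n)"] hardy_fun_Hardy2 by blast
  have "(\<lambda>n. norm (X n - Abs_hardy g)) \<longlonglongrightarrow> 0"
    using g(2) by (simp add: norm_hardy.rep_eq minus_hardy.rep_eq Abs_hardy_inverse[OF g(1)])
  then show "convergent X"
    unfolding convergent_def by (auto simp: tendsto_norm_zero_iff LIM_zero_iff)
qed

section \<open>Multiplication by an inner function\<close>

lemma inner_functionD:
  assumes "inner_function \<phi>"
  obtains B where "analytic_on_polydisc \<phi>" "\<And>z. z \<in> polydisc \<Longrightarrow> cmod (\<phi> z) \<le> B"
proof -
  have a: "analytic_on_polydisc \<phi>" and b: "bounded (\<phi> ` polydisc)"
    using assms by (auto simp: inner_function_def Hardy_infty_def)
  from b obtain B where "\<forall>x\<in>\<phi> ` polydisc. cmod x \<le> B" by (auto simp: bounded_iff)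
  with a that show ?thesis by auto
qed

lemma inner_function_const: "cmod c = 1 \<Longrightarrow> inner_function (\<lambda>_. c)"
  by (auto simp: inner_function_def Hardy_infty_def analytic_const bounded_iff
      intro!: AE_I2 exI[of _ c])

lemma radial_mean_of_dilation:
  assumes f: "f \<in> polydisc_functions" and s: "0 \<le> s" "s \<le> 1" and r: "0 \<le> r" "r < 1"
  shows "radial_mean (dilation s f) r = radial_mean f (s * r)"
proof -
  note [measurable] = polydisc_functions_measurable[OF f]
    polydisc_functions_measurable[OF polydisc_functions_dilation[OF f s]]
  show ?thesis
    unfolding radial_mean_def
  proof (rule integral_cong_AE)
  show "AE z in torus_measure. (cmod (dilation s f (r *\<^sub>R z)))\<^sup>2 = (cmod (f ((s * r) *\<^sub>R z)))\<^sup>2"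
    using AE_torus_measure
  proof eventually_elim
    case (elim z)
    then have "r *\<^sub>R z \<in> polydisc"
      using scaleR_torus r closed_polydisc_subset by blast
    then show ?case by (simp add: dilation_def)
  qed
  qed simp_all
qed

lemma dilation_Hardy2:
  assumes f: "f \<in> Hardy2" and s: "0 \<le> s" "s \<le> 1"
  shows "dilation s f \<in> Hardy2"
proof (rule Hardy2I(1)[OF polydisc_functions_dilation[OF Hardy2_polydisc_functions[OF f] s]])
  fix r :: real assume r: "0 \<le> r" "r < 1"
  show "radial_mean (dilation s f) r \<le> (hnorm f)\<^sup>2"
    unfolding radial_mean_of_dilation[OF Hardy2_polydisc_functions[OF f] s r]
    by (rule radial_mean_le_hnorm[OF f]) (use r s in \<open>auto
        intro: le_less_trans[OF mult_left_le_one_le]\<close>)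
qed

text \<open>For \<open>s < 1\<close> the dilation of \<open>f\<close> is continuous up to the torus, so the integrands \<open>|\<phi> (r z) f
(s r z)|\<^sup>2\<close> converge to \<open>|f (s z)|\<^sup>2\<close> for almost every \<open>z\<close> as \<open>r\<close> tends to 1; they are bounded.\<close>
lemma hnorm_inner_dilation:
  fixes \<phi> :: "complex ^ 'n::finite \<Rightarrow> complex"
  assumes \<phi>: "inner_function \<phi>" and f: "f \<in> Hardy2" and s: "0 \<le> s" "s < 1"
  shows "(hnorm (\<lambda>z. \<phi> z * dilation s f z))\<^sup>2 = radial_mean f s"
proof -
  obtain B where a: "analytic_on_polydisc \<phi>" and B: "\<And>z. z \<in> polydisc \<Longrightarrow> cmod (\<phi> z) \<le> B"
    using inner_functionD[OF \<phi>] by metis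
  have fp: "f \<in> polydisc_functions" by (rule Hardy2_polydisc_functions[OF f])
  have d: "dilation s f \<in> Hardy2" using dilation_Hardy2[OF f] s by simp
  let ?g = "\<lambda>z. \<phi> z * dilation s f z"
  have g: "?g \<in> Hardy2" by (rule Hardy2_bounded_mult(1)[OF d a B])
  note [measurable] = polydisc_functions_measurable[OF fp]
    polydisc_functions_measurable[OF Hardy2_polydisc_functions[OF g]]
  obtain C where C: "\<And>z. z \<in> closed_polydisc s \<Longrightarrow> cmod (f z) \<le> C"
    using analytic_bounded[OF polydisc_functionsD(1)[OF fp] s(2)] by blast
  \<comment> \<open>Dominated convergence is applied along a sequence of radii increasing to 1.\<close>
  define X where "X n = 1 - 1 / real (Suc n)" for n
  have X: "0 \<le> X n" "X n < 1" for n by (auto simp: X_def)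
  have "X \<longlonglongrightarrow> 1 - 0"
    unfolding X_def using LIMSEQ_inverse_real_of_nat
        by (intro tendsto_intros) (simp add: inverse_eq_divide)
  then have Xl: "filterlim X (at_left 1) sequentially"
    by (simp add: filterlim_at X X(2)[THEN less_imp_neq])
  have "(\<lambda>n. radial_mean ?g (X n)) \<longlonglongrightarrow> radial_mean f s"
    unfolding radial_mean_def
  proof (rule integral_dominated_convergence[where w = "\<lambda>_. (B * C)\<^sup>2"])
    have "AE z in torus_measure. \<exists>w. ((\<lambda>r. \<phi> (r *\<^sub>R z)) \<longlongrightarrow> w) (at_left 1) \<and> cmod w = 1"
      using \<phi> by (simp add: inner_function_def)
    then show "AE z in torus_measure. (\<lambda>n. (cmod (\<phi> (X n *\<^sub>R z) * dilation s f (X n *\<^sub>R z)))\<^sup>2) \<longlonglongrightarrow>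
        (cmod (f (s *\<^sub>R z)))\<^sup>2"
      using AE_torus_measure
    proof eventually_elim
      case (elim z)
      then obtain w where w: "((\<lambda>r. \<phi> (r *\<^sub>R z)) \<longlongrightarrow> w) (at_left 1)" "cmod w = 1" by blast
      have Xz: "X n *\<^sub>R z \<in> polydisc" for n
        using scaleR_torus[OF elim(2) X(1)] closed_polydisc_subset[OF X(2)] by blast
      have sz: "s *\<^sub>R z \<in> polydisc"
        using scaleR_torus[OF elim(2) s(1)] closed_polydisc_subset[OF s(2)] by blast
      have "isCont f (s *\<^sub>R z)"
        using analytic_imp_continuous_on[OF polydisc_functionsD(1)[OF fp]] sz
          continuous_on_eq_continuous_at[OF open_polydisc] by blast
      moreover have "(\<lambda>n. s *\<^sub>R (X n *\<^sub>R z)) \<longlonglongrightarrow> s *\<^sub>R (1 *\<^sub>R z)"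
        using \<open>X \<longlonglongrightarrow> 1 - 0\<close> by (intro tendsto_intros) simp
      ultimately have "(\<lambda>n. f (s *\<^sub>R (X n *\<^sub>R z))) \<longlonglongrightarrow> f (s *\<^sub>R z)"
        using isCont_tendsto_compose by fastforce
      then have "(\<lambda>n. dilation s f (X n *\<^sub>R z)) \<longlonglongrightarrow> f (s *\<^sub>R z)"
        by (simp only: dilation_def Xz if_True)
      moreover have "(\<lambda>n. \<phi> (X n *\<^sub>R z)) \<longlonglongrightarrow> w"
        by (rule filterlim_compose[OF w(1) Xl])
      ultimately have "(\<lambda>n. (cmod (\<phi> (X n *\<^sub>R z) * dilation s f (X n *\<^sub>R z)))\<^sup>2) \<longlonglongrightarrow>
          (cmod (w * f (s *\<^sub>R z)))\<^sup>2"
        by (intro tendsto_intros)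
      then show ?case by (simp add: norm_mult w)
    qed
    show "AE z in torus_measure. norm ((cmod (\<phi> (X n *\<^sub>R z) * dilation s f (X n *\<^sub>R z)))\<^sup>2) \<le>
        (B * C)\<^sup>2" for n
      using AE_torus_measure
    proof eventually_elim
      case (elim z)
      have Xz: "X n *\<^sub>R z \<in> polydisc"
        using scaleR_torus[OF elim X(1)] closed_polydisc_subset[OF X(2)] by blast
      have "s *\<^sub>R (X n *\<^sub>R z) \<in> closed_polydisc s"
        using elim X[of n] s by (auto simp: closed_polydisc_def torus_def norm_mult
            intro: mult_left_le_one_le mult_left_le)
      with C Xz have "cmod (dilation s f (X n *\<^sub>R z)) \<le> C" by (simp add: dilation_def)
      moreover have "0 \<le> B" by (rule order_trans[OF norm_ge_zero B[OF Xz]])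
      ultimately have "cmod (\<phi> (X n *\<^sub>R z) * dilation s f (X n *\<^sub>R z)) \<le> B * C"
        unfolding norm_mult using B[OF Xz] by (intro mult_mono) auto
      then show ?case by (simp add: power_mono)
    qed
  qed auto
  moreover have "(\<lambda>n. radial_mean ?g (X n)) \<longlonglongrightarrow> (hnorm ?g)\<^sup>2"
    by (rule filterlim_compose[OF radial_mean_tendsto_hnorm[OF g] Xl])
  ultimately show ?thesis by (rule LIMSEQ_unique[rotated])
qed

lemma hnorm_dilation: "f \<in> Hardy2 \<Longrightarrow> 0 \<le> s \<Longrightarrow> s < 1 \<Longrightarrow> (hnorm (dilation s f))\<^sup>2 = radial_mean f s"
  using hnorm_inner_dilation[OF inner_function_const[of 1]] by simp

text \<open>As \<open>s\<close> tends to 1, the radial mean tends to the squared norm of \<open>f\<close>. So this inequality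
shows that the dilations converge to \<open>f\<close> in norm.\<close>
lemma hnorm_diff_dilation:
  assumes f: "f \<in> Hardy2" and s: "0 \<le> s" "s < 1"
  shows "(hnorm (\<lambda>z. f z - dilation s f z))\<^sup>2 + radial_mean f s \<le> (hnorm f)\<^sup>2"
proof -
  have d: "dilation s f \<in> Hardy2" using dilation_Hardy2[OF f] s by simp
  show ?thesis
    unfolding hnorm_dilation[OF f s, symmetric]
  proof (rule tendsto_le)
    show "(radial_mean f \<longlongrightarrow> (hnorm f)\<^sup>2) (at_left 1)" by (rule radial_mean_tendsto_hnorm[OF f])
    show "((\<lambda>r. radial_mean (\<lambda>z. f z - dilation s f z) r + radial_mean (dilation s f) r) \<longlongrightarrow>
        (hnorm (\<lambda>z. f z - dilation s f z))\<^sup>2 + (hnorm (dilation s f))\<^sup>2) (at_left 1)"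
      by (intro tendsto_add radial_mean_tendsto_hnorm Hardy2_diff f d)
    show "\<forall>\<^sub>F r in at_left 1. radial_mean (\<lambda>z. f z - dilation s f z) r +
        radial_mean (dilation s f) r \<le> radial_mean f r"
      using eventually_radius
    proof eventually_elim
      case (elim r)
      then show ?case
        using radial_mean_dilation[OF Hardy2_polydisc_functions[OF f], of r s]
          radial_mean_of_dilation[OF Hardy2_polydisc_functions[OF f], of s r] s by simp
    qed
  qed simp
qed

text \<open>Meaningful when \<open>\<phi>\<close> is analytic and bounded on the polydisc, in particular for inner
functions; otherwise the product need not lie in the Hardy space.\<close>
definition hardy_mult :: "(complex ^ 'n::finite \<Rightarrow> complex) \<Rightarrow> 'n hardy \<Rightarrow> 'n hardy" where
  "hardy_mult \<phi> f = Abs_hardy (\<lambda>z. \<phi> z * hardy_fun f z)"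

lemma hardy_fun_mult:
  assumes "inner_function \<phi>"
  shows "hardy_fun (hardy_mult \<phi> f) = (\<lambda>z. \<phi> z * hardy_fun f z)"
proof -
  obtain B where "analytic_on_polydisc \<phi>" "\<And>z. z \<in> polydisc \<Longrightarrow> cmod (\<phi> z) \<le> B"
    using inner_functionD[OF assms] by metis
  then show ?thesis
    unfolding hardy_mult_def by (intro Abs_hardy_inverse Hardy2_bounded_mult(1)) auto
qed

lemma hardy_eq_iff: "f = g \<longleftrightarrow> hardy_fun f = hardy_fun g"
  by (simp add: hardy_fun_inject)

text \<open>The norms of \<open>\<phi> f\<close> and \<open>f\<close> are compared through the dilations \<open>D s\<close> of \<open>f\<close>, for which they
agree. Since multiplication by \<open>\<phi>\<close> is bounded by some \<open>B\<close>, the two norms differ by at most \<open>(B +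
1) \<parallel>f - D s\<parallel>\<close>, and this tends to 0.\<close>
lemma linear_isometry_hardy_mult:
  fixes \<phi> :: "complex ^ 'n::finite \<Rightarrow> complex"
  assumes \<phi>: "inner_function \<phi>"
  shows "linear_isometry (hardy_mult \<phi>)"
proof (rule linear_isometry.intro)
  note mult = hardy_fun_mult[OF \<phi>]
  show lin: "linear (hardy_mult \<phi>)"
    by (rule linearI) (simp_all add: hardy_eq_iff mult plus_hardy.rep_eq scaleR_hardy.rep_eq
        algebra_simps)
  obtain B where B: "analytic_on_polydisc \<phi>" "\<And>z. z \<in> polydisc \<Longrightarrow> cmod (\<phi> z) \<le> B"
    using inner_functionD[OF \<phi>] by metis
  fix f :: "'n hardy"
  let ?V = "hardy_mult \<phi>"
  define D where "D s = Abs_hardy (dilation s (hardy_fun f))" for s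
  have D: "hardy_fun (D s) = dilation s (hardy_fun f)" if "0 \<le> s \<and> s < 1" for s
    unfolding D_def using that by (intro Abs_hardy_inverse dilation_Hardy2) auto
  have "\<bar>norm (?V f) - norm f\<bar> \<le> (B + 1) * sqrt ((norm f)\<^sup>2 - radial_mean (hardy_fun f) s)"
      if s: "0 \<le> s \<and> s < 1" for s
  proof -
    have "(norm (?V (D s)))\<^sup>2 = (norm (D s))\<^sup>2"
      using hnorm_inner_dilation[OF \<phi> hardy_fun_Hardy2, of s f] hnorm_dilation[OF hardy_fun_Hardy2,
          of s f] s
      by (simp add: norm_hardy.rep_eq mult D[OF s])
    then have 1: "norm (?V (D s)) = norm (D s)" by simp
    have "norm (?V f - ?V (D s)) = norm (?V (f - D s))" by (simp add: linear_diff[OF lin])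
    also have "\<dots> \<le> B * norm (f - D s)"
      unfolding norm_hardy.rep_eq mult by (rule Hardy2_bounded_mult(2)[OF hardy_fun_Hardy2 B])
    finally have "\<bar>norm (?V f) - norm (D s)\<bar> \<le> B * norm (f - D s)"
      using norm_triangle_ineq3[of "?V f" "?V (D s)"] 1 by linarith
    moreover have "\<bar>norm f - norm (D s)\<bar> \<le> norm (f - D s)" by (rule norm_triangle_ineq3)
    ultimately have "\<bar>norm (?V f) - norm f\<bar> \<le> (B + 1) * norm (f - D s)" by (simp add: algebra_simps)
    also have "norm (f - D s) \<le> sqrt ((norm f)\<^sup>2 - radial_mean (hardy_fun f) s)"
    proof (rule real_le_rsqrt)
      show "(norm (f - D s))\<^sup>2 \<le> (norm f)\<^sup>2 - radial_mean (hardy_fun f) s"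
        using hnorm_diff_dilation[OF hardy_fun_Hardy2, of s f] s
        by (simp add: norm_hardy.rep_eq minus_hardy.rep_eq D[OF s])
    qed
    finally show ?thesis
      using order_trans[OF norm_ge_zero B(2)[of 0]] by (simp add: polydisc_def mult_left_mono)
  qed
  then have "\<forall>\<^sub>F s in at_left 1. \<bar>norm (?V f) - norm f\<bar> \<le> (B +
      1) * sqrt ((norm f)\<^sup>2 - radial_mean (hardy_fun f) s)"
    using eventually_radius by (auto elim: eventually_mono)
  moreover have "((\<lambda>s. (B + 1) * sqrt ((norm f)\<^sup>2 - radial_mean (hardy_fun f) s)) \<longlongrightarrow>
      (B + 1) * sqrt ((norm f)\<^sup>2 - (norm f)\<^sup>2)) (at_left 1)"
    unfolding norm_hardy.rep_eq by (intro tendsto_intros radial_mean_tendsto_hnorm) simp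
  ultimately have "\<bar>norm (?V f) - norm f\<bar> \<le> (B + 1) * sqrt ((norm f)\<^sup>2 - (norm f)\<^sup>2)"
    by (intro tendsto_lowerbound) auto
  then show "norm (?V f) = norm f" by simp
qed

section \<open>Truncated Toeplitz operators\<close>

text \<open>The complex structure of the Hardy space. As the constant \<open>\<i>\<close> is an inner function, it is an
isometry that commutes with the multiplication by every inner function.\<close>
definition imult :: "'n::finite hardy \<Rightarrow> 'n hardy" where
  "imult = hardy_mult (\<lambda>_. \<i>)"

interpretation imult: linear_isometry imult
  unfolding imult_def by (intro linear_isometry_hardy_mult inner_function_const) simp

lemma hardy_fun_imult: "hardy_fun (imult f) = (\<lambda>z. \<i> * hardy_fun f z)"
  unfolding imult_def by (intro hardy_fun_mult inner_function_const) simp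

lemma imult_imult: "imult (imult f) = - f"
  by (simp add: hardy_eq_iff hardy_fun_imult uminus_hardy.rep_eq fun_eq_iff flip: mult.assoc)

lemma inner_imult_left: "imult f \<bullet> g = - (f \<bullet> imult g)"
  using imult.inner_eq[of "imult f" g] by (simp add: imult_imult)

definition cmult :: "complex \<Rightarrow> 'n::finite hardy \<Rightarrow> 'n hardy" where
  "cmult c f = Re c *\<^sub>R f + Im c *\<^sub>R imult f"

lemma hardy_fun_cmult: "hardy_fun (cmult c f) = (\<lambda>z. c * hardy_fun f z)"
proof
  fix z
  have "hardy_fun (cmult c f) z = (complex_of_real (Re c) + \<i> * complex_of_real (Im c)) * hardy_fun f z"
    by (simp add: cmult_def plus_hardy.rep_eq scaleR_hardy.rep_eq hardy_fun_imult algebra_simps)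
  then show "hardy_fun (cmult c f) z = c * hardy_fun f z" by (simp flip: complex_eq)
qed

lemma hinner_hardy_fun: "hinner (hardy_fun f) (hardy_fun g) = Complex (f \<bullet> g) (f \<bullet> imult g)"
  by (simp add: hinner_eq inner_hardy.rep_eq hardy_fun_imult)

text \<open>The imaginary part of the complex inner product with \<open>g\<close> is the real inner product with \<open>\<i>
g\<close>.\<close>
lemma hinner_zero_iff:
  assumes "\<And>g. g \<in> M \<Longrightarrow> imult g \<in> M"
  shows "(\<forall>g\<in>M. hinner (hardy_fun f) (hardy_fun g) = 0) \<longleftrightarrow> (\<forall>g\<in>M. f \<bullet> g = 0)"
  using assms by (auto simp: hinner_hardy_fun complex_eq_iff)

lemma Hardy2_eq_range: "Hardy2 = range hardy_fun"
  by (rule type_definition.Rep_range[OF type_definition_hardy, symmetric])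

lemma orth_compl_hardy_fun:
  assumes "\<And>g. g \<in> M \<Longrightarrow> imult g \<in> M"
  shows "orth_compl (hardy_fun ` S) (hardy_fun ` M) = hardy_fun ` {f \<in> S. \<forall>g\<in>M. f \<bullet> g = 0}"
proof -
  have "(\<forall>g\<in>hardy_fun ` M. hinner (hardy_fun f) g = 0) \<longleftrightarrow> (\<forall>g\<in>M. f \<bullet> g = 0)" for f
    using hinner_zero_iff[OF assms] by simp
  then show ?thesis unfolding orth_compl_def by blast
qed

lemma orth_proj_hardy_fun:
  assumes S: "subspace S" "\<And>g. g \<in> S \<Longrightarrow> imult g \<in> S"
    and p: "p \<in> S" "\<And>h. h \<in> S \<Longrightarrow> (f - p) \<bullet> h = 0"
  shows "orth_proj (hardy_fun ` S) (hardy_fun f) = hardy_fun p"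
  unfolding orth_proj_def
proof (rule the_equality)
  have iff: "(\<forall>h\<in>hardy_fun ` S. hinner (\<lambda>z. hardy_fun f z - hardy_fun q z) h = 0) \<longleftrightarrow>
      (\<forall>h\<in>S. (f - q) \<bullet> h = 0)" for q
    using hinner_zero_iff[OF S(2), of "f - q"] by (simp add: minus_hardy.rep_eq)
  show "hardy_fun p \<in> hardy_fun ` S \<and> (\<forall>h\<in>hardy_fun ` S. hinner (\<lambda>z. hardy_fun f z - hardy_fun p z)
      h = 0)"
    unfolding iff using p by blast
  fix g assume "g \<in> hardy_fun ` S \<and> (\<forall>h\<in>hardy_fun ` S. hinner (\<lambda>z. hardy_fun f z - g z) h = 0)"
  then obtain q where "g = hardy_fun q" "q \<in> S" "\<forall>h\<in>S. (f - q) \<bullet> h = 0"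
    using iff by blast
  then show "g = hardy_fun p"
    using orthogonal_projection_unique[OF S(1), of p f q] p by simp
qed

lemma hardy_mult_commute:
  assumes "inner_function \<phi>" "inner_function \<theta>"
  shows "hardy_mult \<phi> (hardy_mult \<theta> f) = hardy_mult \<theta> (hardy_mult \<phi> f)"
  by (simp add: hardy_eq_iff hardy_fun_mult assms mult.left_commute)

lemma hardy_mult_imult:
  assumes "inner_function \<phi>"
  shows "hardy_mult \<phi> (imult f) = imult (hardy_mult \<phi> f)"
  unfolding imult_def by (rule hardy_mult_commute[OF assms inner_function_const]) simp

text \<open>The model space is the cokernel of the multiplication \<open>V\<close> by \<open>\<phi>\<close>, and the truncated Toeplitz
operator is the compression of the multiplication by \<open>\<theta>\<close> to it. It is a contraction, and complex
linear because the projection commutes with the complex structure. Since \<open>\<parallel>\<theta> f\<parallel> = \<parallel>f\<parallel>\<close>, it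
preserves the norm of \<open>f\<close> if and only if \<open>\<theta> f\<close> lies in the model space.\<close>
lemma partial_isometry_truncated_Toeplitz_iff:
  fixes \<phi> \<theta> :: "complex ^ 'n::finite \<Rightarrow> complex"
  assumes \<phi>: "inner_function \<phi>" and \<theta>: "inner_function \<theta>"
  shows "partial_isometry_on (model_space \<phi>) (truncated_Toeplitz \<phi> \<theta>) \<longleftrightarrow>
    compression_partial_isometry (hardy_mult \<phi>) (hardy_mult \<theta>)"
proof -
  let ?V = "hardy_mult \<phi>" and ?W = "hardy_mult \<theta>"
  interpret V: linear_isometry ?V by (rule linear_isometry_hardy_mult[OF \<phi>])
  interpret W: linear_isometry ?W by (rule linear_isometry_hardy_mult[OF \<theta>])
  let ?Q = "V.cokernel" and ?N = "compression_kernel ?V ?W"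
  let ?T = "truncated_Toeplitz \<phi> \<theta>"
  have iV: "?V (imult f) = imult (?V f)" and iW: "?W (imult f) = imult (?W f)" for f
    by (rule hardy_mult_imult[OF \<phi>], rule hardy_mult_imult[OF \<theta>])
  have iQ: "imult f \<in> ?Q" if "f \<in> ?Q" for f
    using that by (simp add: V.cokernel_def inner_imult_left flip: iV)
  have iN: "imult f \<in> ?N" if "f \<in> ?N" for f
    using that iQ by (auto simp: compression_kernel_def iW image_iff simp flip: iV)
  have Q: "model_space \<phi> = hardy_fun ` ?Q"
  proof -
    have "(\<lambda>g z. \<phi> z * g z) ` Hardy2 = hardy_fun ` range ?V"
      by (simp add: Hardy2_eq_range image_image hardy_fun_mult[OF \<phi>])
    then have "model_space \<phi> = hardy_fun ` {f \<in> UNIV. \<forall>g\<in>range ?V. f \<bullet> g = 0}"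
      unfolding model_space_def Hardy2_eq_range
      by (simp only:) (rule orth_compl_hardy_fun, auto simp flip: iV)
    then show ?thesis by (simp add: V.cokernel_def)
  qed
  have T: "?T (hardy_fun f) = hardy_fun (V.proj (?W f))" for f
    unfolding truncated_Toeplitz_def Q hardy_fun_mult[OF \<theta>, symmetric]
    by (intro orth_proj_hardy_fun V.subspace_cokernel iQ V.proj V.proj_orthogonal)
  have i_proj: "V.proj (imult f) = imult (V.proj f)" for f
  proof -
    obtain k where k: "f = V.proj f + ?V k" using V.proj(2) by blast
    have "imult f = imult (V.proj f) + ?V (imult k)"
      by (subst k) (simp add: linear_add[OF imult.linear] iV)
    then show ?thesis using V.proj_eqI[OF iQ[OF V.proj(1)]] by metis
  qed
  have c_proj: "V.proj (cmult c f) = cmult c (V.proj f)" for c f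
    by (simp add: cmult_def linear_add[OF V.linear_proj] linear_scale[OF V.linear_proj] i_proj)
  have cW: "?W (cmult c f) = cmult c (?W f)" for c f
    by (simp add: cmult_def linear_add[OF W.linear] linear_scale[OF W.linear] iW)
  have bounded: "bounded_operator_on (model_space \<phi>) ?T"
    unfolding bounded_operator_on_def
  proof (intro conjI ballI allI exI[of _ 1])
    fix f g c assume "f \<in> model_space \<phi>"
    then obtain F where F: "f = hardy_fun F" unfolding Q by blast
    show "?T f \<in> model_space \<phi>" unfolding F T Q by (intro imageI V.proj)
    show "hnorm (?T f) \<le> 1 * hnorm f"
      unfolding F T norm_hardy.rep_eq[symmetric] using V.norm_proj_le[of "?W F"]
          by (simp add: W.norm_eq)
    show "?T (\<lambda>z. c * f z) = (\<lambda>z. c * ?T f z)"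
      unfolding F hardy_fun_cmult[symmetric] T by (simp add: cW c_proj)
    assume "g \<in> model_space \<phi>"
    then obtain G where G: "g = hardy_fun G" unfolding Q by blast
    show "?T (\<lambda>z. f z + g z) = (\<lambda>z. ?T f z + ?T g z)"
      unfolding F G plus_hardy.rep_eq[symmetric] T
      by (simp add: linear_add[OF W.linear] linear_add[OF V.linear_proj])
  qed
  have kernel: "{g \<in> model_space \<phi>. ?T g = (\<lambda>z. 0)} = hardy_fun ` ?N"
  proof -
    have "hardy_fun f = (\<lambda>z. 0) \<longleftrightarrow> f = 0" for f :: "'n hardy"
      by (simp add: hardy_eq_iff zero_hardy.rep_eq)
    then have "?T (hardy_fun f) = (\<lambda>z. 0) \<longleftrightarrow> ?W f \<in> range ?V" for f
      by (simp only: T V.proj_eq_0_iff)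
    then show ?thesis unfolding Q compression_kernel_def by auto
  qed
  have perp: "orth_compl (hardy_fun ` ?Q) (hardy_fun ` ?N) = hardy_fun ` {f \<in> ?Q. \<forall>g\<in>?N. f \<bullet> g = 0}"
    by (rule orth_compl_hardy_fun) (rule iN)
  have "hnorm (?T (hardy_fun f)) = hnorm (hardy_fun f) \<longleftrightarrow> ?W f \<in> ?Q" for f
    unfolding T norm_hardy.rep_eq[symmetric] using V.norm_proj_eq_iff[of "?W f"]
        by (simp add: W.norm_eq)
  then show ?thesis
    unfolding partial_isometry_on_def kernel compression_partial_isometry_def
    unfolding Q perp
    using bounded[unfolded Q] by auto
qed

theorem corollary4p5:
  fixes \<phi>\<^sub>1 \<phi>\<^sub>2 :: "complex ^ 'n::finite \<Rightarrow> complex"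
  assumes "inner_function \<phi>\<^sub>1" and "\<not> \<phi>\<^sub>1 constant_on polydisc"
    and "inner_function \<phi>\<^sub>2" and "\<not> \<phi>\<^sub>2 constant_on polydisc"
  shows "partial_isometry_on (model_space \<phi>\<^sub>1) (truncated_Toeplitz \<phi>\<^sub>1 \<phi>\<^sub>2) \<longleftrightarrow>
         partial_isometry_on (model_space \<phi>\<^sub>2) (truncated_Toeplitz \<phi>\<^sub>2 \<phi>\<^sub>1)"
proof -
  let ?V = "hardy_mult \<phi>\<^sub>1" and ?W = "hardy_mult \<phi>\<^sub>2"
  note V = linear_isometry_hardy_mult[OF assms(1)] and W = linear_isometry_hardy_mult[OF assms(3)]
  have comm: "?V (?W f) = ?W (?V f)" for f
    by (rule hardy_mult_commute[OF assms(1,3)])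
  show ?thesis
    unfolding partial_isometry_truncated_Toeplitz_iff[OF assms(1,3)]
      partial_isometry_truncated_Toeplitz_iff[OF assms(3,1)]
    using compression_partial_isometry_swap[OF V W comm]
      compression_partial_isometry_swap[OF W V comm[symmetric]] by blast
qed

end
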